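(* Let $\mathcal{F}$ be a non-empty, displacement convex subset of $\mathcal{P}_2(\mathbb{R})$ which is closed with respect to $\mathcal{W}_2$, and let $\mathrm{proj}_{\mathcal{F}}$ denote the $2$-Wasserstein projection onto $\mathcal{F}$. Suppose that $\mu^* \in \mathcal{P}_2(\mathbb{R})$. Let $\mu_n = \sum_{i=1}^n \frac{1}{n}\delta_{X_i}$, where $X_1, X_2, \ldots$ are i.i.d. samples from $\mu^*$, and let $\hat{\mu}_n := \mathrm{proj}_{\mathcal{F}}\,\mu_n$. Then $$\mathcal{W}_2(\hat{\mu}_n, \mathrm{proj}_{\mathcal{F}}\,\mu^* ) \le \mathcal{W}_2(\mu_n,\mu^* ).$$ In particular, $$\lim_{n\to\infty} \mathcal{W}_2(\hat{\mu}_n, \mathrm{proj}_{\mathcal{F}}\,\mu^* ) = 0 \quad \text{almost surely}.$$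
   Context: $\mathcal{P}_2(\mathbb{R})$ is the set of Borel probability measures on $\mathbb{R}$ with finite second moment. $\mathcal{W}_2(\mu,\nu) = \left(\inf_{\pi} \int |x-y|^2\,d\pi(x,y)\right)^{1/2}$, the infimum being over all couplings $\pi$ of $\mu$ and $\nu$. The quantile function of $\mu$ is $Q_\mu(u) = \inf\{x : \mu((-\infty,x]) \ge u\}$, $u\in(0,1)$. A set $\mathcal{F}$ of Borel probability measures on $\mathbb{R}$ is displacement convex if $\{Q_\mu : \mu\in\mathcal{F}\}$ is a convex set of functions. For such a non-empty $\mathcal{W}_2$-closed $\mathcal{F} \subset \mathcal{P}_2(\mathbb{R})$ and $\mu\in\mathcal{P}_2(\mathbb{R})$, $\mathrm{proj}_{\mathcal{F}}\,\mu$ denotes the unique minimizer (which exists) of $\nu\mapsto\mathcal{W}_2(\nu,\mu)$ over $\nu\in\mathcal{F}$. *)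

theory Defs
  imports "HOL-Probability.Probability"
begin

definition P2 :: "real measure set" where
  "P2 = {\<mu>. real_distribution \<mu> \<and> integrable \<mu> (\<lambda>x. x\<^sup>2)}"

definition couplings :: "real measure \<Rightarrow> real measure \<Rightarrow> (real \<times> real) measure set" where
  "couplings \<mu> \<nu> = {\<pi>. prob_space \<pi> \<and> sets \<pi> = sets (borel \<Otimes>\<^sub>M borel) \<and>
     distr \<pi> borel fst = \<mu> \<and> distr \<pi> borel snd = \<nu>}"

(* The infimum is taken in the extended nonnegative reals; it is finite for \<mu>, \<nu> in P2, so the
   convention enn2real \<infinity> = 0 only matters outside P2. *)
definition W2 :: "real measure \<Rightarrow> real measure \<Rightarrow> real" where
  "W2 \<mu> \<nu> = sqrt (enn2real
     (INF \<pi> \<in> couplings \<mu> \<nu>. \<integral>\<^sup>+ (x, y). ennreal (\<bar>x - y\<bar>\<^sup>2) \<partial>\<pi>))"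

(* Restricted to (0,1), so that equality of quantile functions is equality on (0,1). *)
definition quantile :: "real measure \<Rightarrow> real \<Rightarrow> real" where
  "quantile \<mu> = (\<lambda>u\<in>{0<..<1}. Inf {x. cdf \<mu> x \<ge> u})"

(* The library predicate "convex" is not available for sets of functions, as function types carry
   no real vector space instance; this is its definition for functions on (0,1). *)
definition displacement_convex :: "real measure set \<Rightarrow> bool" where
  "displacement_convex F \<longleftrightarrow>
     (\<forall>f\<in>quantile ` F. \<forall>g\<in>quantile ` F. \<forall>s\<ge>0. \<forall>t\<ge>0. s + t = 1 \<longrightarrow>
        (\<lambda>u\<in>{0<..<1}. s * f u + t * g u) \<in> quantile ` F)"

(* W2 is a metric on P2; the definition of mtopology itself, in terms of W2-balls, makes sense without
   that fact. In particular W2_closed F includes F \<subseteq> P2. *)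
definition W2_closed :: "real measure set \<Rightarrow> bool" where
  "W2_closed F \<longleftrightarrow> closedin (Metric_space.mtopology P2 W2) F"

(* Meaningful for non-empty, displacement convex, W2-closed F and \<mu> in P2, in which case the
   minimizer exists and is unique. *)
definition W2_proj :: "real measure set \<Rightarrow> real measure \<Rightarrow> real measure" where
  "W2_proj F \<mu> = (THE \<nu>. is_arg_min (\<lambda>\<nu>. W2 \<nu> \<mu>) (\<lambda>\<nu>. \<nu> \<in> F) \<nu>)"

(* Sum over i = 1..n of 1/n times the Dirac measure at x i; only used for n \<ge> 1. *)
definition empirical_measure :: "nat \<Rightarrow> (nat \<Rightarrow> real) \<Rightarrow> real measure" where
  "empirical_measure n x = measure_of UNIV (sets borel)
     (\<lambda>A. \<Sum>i=1..n. ennreal (1 / real n) * emeasure (return borel (x i)) A)"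

lemma emeasure_empirical_measure:
  assumes A: "A \<in> sets borel"
  shows "emeasure (empirical_measure n x) A = (\<Sum>i=1..n. ennreal (1 / real n) * emeasure (return borel (x i)) A)"
  unfolding empirical_measure_def
proof (rule emeasure_measure_of_sigma)
  show "sigma_algebra UNIV (sets (borel::real measure))" by (metis sets.sigma_algebra_axioms space_borel)
  show "countably_additive (sets borel) (\<lambda>A. \<Sum>i = 1..n. ennreal (1 / real n) * emeasure (return borel (x i)) A)"
  proof (rule countably_additiveI)
    fix A :: "nat \<Rightarrow> real set" assume a: "range A \<subseteq> sets borel" "disjoint_family A"
    have s: "(\<Sum>j. emeasure (return borel (x i)) (A j)) = emeasure (return borel (x i)) (\<Union> (range A))" for i
      by (rule suminf_emeasure) (use a in simp_all)
    have "(\<Sum>j. \<Sum>i = 1..n. ennreal (1 / real n) * emeasure (return borel (x i)) (A j)) =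
       (\<Sum>i = 1..n. \<Sum>j. ennreal (1 / real n) * emeasure (return borel (x i)) (A j))"
      by (rule suminf_sum) (rule summableI)
    then show "(\<Sum>j. \<Sum>i = 1..n. ennreal (1 / real n) * emeasure (return borel (x i)) (A j)) =
      (\<Sum>i = 1..n. ennreal (1 / real n) * emeasure (return borel (x i)) (\<Union> (range A)))"
      by (simp only: ennreal_suminf_cmult s)
  qed
  show "positive (sets borel) (\<lambda>A. \<Sum>i = 1..n. ennreal (1 / real n) * emeasure (return borel (x i)) A)"
    by (simp add: positive_def)
qed (rule A)

end

theory Submission
  imports Defs
begin

text \<open>
  A Tonelli argument with the kernel \<open>1[x \<le> s, t < y] + 1[y \<le> s, t < x]\<close> on \<open>s < t\<close> bounds the cost
  of every coupling below by an expression in the two distribution functions that the coupling of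
  the quantile functions attains. So \<open>\<mu> \<mapsto> Q\<^sub>\<mu>\<close> embeds \<open>P2\<close> isometrically into \<open>L\<^sup>2(0,1)\<close>, the image of
  a displacement convex closed set is convex and complete, and the projection is the nonexpansive
  Hilbert space projection.

  For the almost sure convergence \<open>W2 \<mu>\<^sub>n \<mu> \<longrightarrow> 0\<close>, Hoeffding's inequality gives weak convergence of
  \<open>\<mu>\<^sub>n\<close>, and Skorohod's coupling reduces the claim to a bound on the second moments of the
  tails of \<open>\<mu>\<^sub>n\<close>. A law of large numbers with the constant 2 suffices for that; truncation at
  the dyadic times \<open>2\<^sup>k\<close>, Chebyshev's inequality and the Borel--Cantelli lemma prove it.
\<close>

subsection \<open>The quantile representation of the Wasserstein distance\<close>

text \<open>For x < y the triangle x <= s < t < y has area (y - x)^2 / 2, which is where the kernel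
  comes from. After the exchange of integrals a coupling enters only through the probabilities of {X
  <= s, t < Y} and its mirror image. The marginals bound these from below, and the bound is sharp
  for all s < t at once when both variables are nondecreasing functions of one uniform variable.

  A limit of quantile functions is available only almost everywhere. Instead of correcting it to a
  quantile function, the proof passes to its law: a minimizer needs only upper bounds on its
  distances, and any pair of random variables with the right laws provides those.

  For the tails, only first moments of squares of the samples are finite, so Chebyshev's inequality
  needs truncation. The times 2^k avoid a maximal inequality; filling the gaps by monotonicity of
  the sums costs the factor 2. The loss is harmless, because it multiplies tail moments that vanish
  as the cutoff grows.\<close>

lemma nn_integral_triangle:
  fixes a b :: real
  shows "(\<integral>\<^sup>+s. \<integral>\<^sup>+t. (if s < t \<and> a \<le> s \<and> t < b then 1 else 0) \<partial>lborel \<partial>lborel)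
    = ennreal ((max 0 (b - a))\<^sup>2 / 2)"
proof -
  have inner: "(\<integral>\<^sup>+t. (if s < t \<and> a \<le> s \<and> t < b then 1 else 0) \<partial>lborel)
      = ennreal (b - s) * indicator {a..b} s" for s
  proof -
    have "(\<integral>\<^sup>+t. (if s < t \<and> a \<le> s \<and> t < b then 1 else 0) \<partial>lborel)
        = (\<integral>\<^sup>+t. indicator (if a \<le> s then {s<..<b} else {}) t \<partial>lborel)"
      by (intro nn_integral_cong) auto
    also have "\<dots> = ennreal (b - s) * indicator {a..b} s"
      by (subst nn_integral_indicator) (auto split: split_indicator simp: ennreal_neg)
    finally show ?thesis .
  qed
  show ?thesis
  proof (cases "a \<le> b")
    case True
    have "(\<integral>\<^sup>+s. ennreal (b - s) * indicator {a..b} s \<partial>lborel) = ennreal (- (b - b)\<^sup>2 / 2 - (- (b - a)\<^sup>2 / 2))"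
      using True by (intro nn_integral_FTC_Icc) (auto intro!: derivative_eq_intros simp: field_simps)
    with True show ?thesis by (simp add: inner)
  next
    case False
    then have "(\<integral>\<^sup>+s. ennreal (b - s) * indicator {a..b} s \<partial>lborel) = 0"
      by simp
    with False show ?thesis by (simp add: inner)
  qed
qed

text \<open>Tonelli's theorem, applied twice to the indicator \<open>k\<close>, moves the
  expectation inside both Lebesgue integrals, where the indicator becomes the probability of an
  event.\<close>

lemma (in prob_space) nn_integral_triangle_random_variables:
  fixes X Y :: "'a \<Rightarrow> real"
  assumes [measurable]: "random_variable borel X" "random_variable borel Y"
  shows "(\<integral>\<^sup>+\<omega>. ennreal ((max 0 (Y \<omega> - X \<omega>))\<^sup>2 / 2) \<partial>M)
    = (\<integral>\<^sup>+s. \<integral>\<^sup>+t. (if s < t then emeasure M {\<omega>\<in>space M. X \<omega> \<le> s \<and> t < Y \<omega>} else 0) \<partial>lborel \<partial>lborel)"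
proof -
  interpret L: pair_sigma_finite M lborel ..
  define k :: "'a \<Rightarrow> real \<Rightarrow> real \<Rightarrow> ennreal"
    where "k \<omega> s t = (if s < t \<and> X \<omega> \<le> s \<and> t < Y \<omega> then 1 else 0)" for \<omega> s t
  have [measurable]: "(\<lambda>p. k (fst p) (fst (snd p)) (snd (snd p))) \<in> borel_measurable (M \<Otimes>\<^sub>M (lborel \<Otimes>\<^sub>M lborel))"
    unfolding k_def by measurable
  have inner: "(\<integral>\<^sup>+\<omega>. k \<omega> s t \<partial>M) = (if s < t then emeasure M {\<omega>\<in>space M. X \<omega> \<le> s \<and> t < Y \<omega>} else 0)" for s t
  proof -
    have "(\<integral>\<^sup>+\<omega>. k \<omega> s t \<partial>M) = (\<integral>\<^sup>+\<omega>. indicator (if s < t then {\<omega>\<in>space M. X \<omega> \<le> s \<and> t < Y \<omega>} else {}) \<omega> \<partial>M)"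
      by (intro nn_integral_cong) (auto simp: k_def)
    then show ?thesis by simp
  qed
  have "(\<integral>\<^sup>+\<omega>. ennreal ((max 0 (Y \<omega> - X \<omega>))\<^sup>2 / 2) \<partial>M) = (\<integral>\<^sup>+\<omega>. \<integral>\<^sup>+s. \<integral>\<^sup>+t. k \<omega> s t \<partial>lborel \<partial>lborel \<partial>M)"
    by (simp only: nn_integral_triangle k_def)
  also have "\<dots> = (\<integral>\<^sup>+s. \<integral>\<^sup>+\<omega>. \<integral>\<^sup>+t. k \<omega> s t \<partial>lborel \<partial>M \<partial>lborel)"
    by (rule L.Fubini'[symmetric]) (simp add: k_def)
  also have "\<dots> = (\<integral>\<^sup>+s. \<integral>\<^sup>+t. \<integral>\<^sup>+\<omega>. k \<omega> s t \<partial>M \<partial>lborel \<partial>lborel)"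
    by (intro nn_integral_cong L.Fubini'[symmetric]) (simp add: k_def)
  finally show ?thesis
    by (simp only: inner)
qed

text \<open>This is the one-sided cost ((Y - X)^+)^2 of the quantile coupling of two laws with cdfs
  \<open>F\<close> and \<open>G\<close>. The conversion \<open>ennreal\<close> truncates negative
  differences to 0, and this positive part is the least probability of {X <= s, t < Y} that the
  marginals allow.\<close>

definition hoeffding_cost :: "(real \<Rightarrow> real) \<Rightarrow> (real \<Rightarrow> real) \<Rightarrow> ennreal" where
  "hoeffding_cost F G = 2 * (\<integral>\<^sup>+s. \<integral>\<^sup>+t. (if s < t then ennreal (F s - G t) else 0) \<partial>lborel \<partial>lborel)"

text \<open>At each point at most one of the two triangles is nonempty, so the square is the sum of
  its one-sided parts; the factor 2 undoes the 1/2 in the area.\<close>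

lemma (in prob_space) nn_integral_power2_diff:
  fixes X Y :: "'a \<Rightarrow> real"
  assumes [measurable]: "random_variable borel X" "random_variable borel Y"
  shows "(\<integral>\<^sup>+\<omega>. ennreal ((X \<omega> - Y \<omega>)\<^sup>2) \<partial>M)
    = 2 * (\<integral>\<^sup>+s. \<integral>\<^sup>+t. (if s < t then emeasure M {\<omega>\<in>space M. X \<omega> \<le> s \<and> t < Y \<omega>} else 0) \<partial>lborel \<partial>lborel)
    + 2 * (\<integral>\<^sup>+s. \<integral>\<^sup>+t. (if s < t then emeasure M {\<omega>\<in>space M. Y \<omega> \<le> s \<and> t < X \<omega>} else 0) \<partial>lborel \<partial>lborel)"
proof -
  have "ennreal ((x - y)\<^sup>2) = 2 * ennreal ((max 0 (y - x))\<^sup>2 / 2) + 2 * ennreal ((max 0 (x - y))\<^sup>2 / 2)" for x y :: real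
  proof -
    have "2 * ennreal r = ennreal (2 * r)" for r by (simp add: ennreal_mult')
    then show ?thesis
      by (auto simp add: max_def power2_commute simp flip: ennreal_plus)
  qed
  then have "(\<integral>\<^sup>+\<omega>. ennreal ((X \<omega> - Y \<omega>)\<^sup>2) \<partial>M)
     = 2 * (\<integral>\<^sup>+\<omega>. ennreal ((max 0 (Y \<omega> - X \<omega>))\<^sup>2 / 2) \<partial>M) + 2 * (\<integral>\<^sup>+\<omega>. ennreal ((max 0 (X \<omega> - Y \<omega>))\<^sup>2 / 2) \<partial>M)"
    by (simp add: nn_integral_add nn_integral_cmult)
  then show ?thesis
    by (simp add: nn_integral_triangle_random_variables)
qed

text \<open>The event {X <= s} is covered by {X <= s, t < Y} and {Y <= t}, so the marginals bound
  the joint probability from below. The resulting bound is the same for every coupling of the two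
  laws.\<close>

lemma (in prob_space) hoeffding_cost_le:
  fixes X Y :: "'a \<Rightarrow> real"
  assumes [measurable]: "random_variable borel X" "random_variable borel Y"
  shows "hoeffding_cost (cdf (distr M borel X)) (cdf (distr M borel Y))
       + hoeffding_cost (cdf (distr M borel Y)) (cdf (distr M borel X))
    \<le> (\<integral>\<^sup>+\<omega>. ennreal ((X \<omega> - Y \<omega>)\<^sup>2) \<partial>M)"
proof -
  have *: "ennreal (cdf (distr M borel X) s - cdf (distr M borel Y) t) \<le> emeasure M {\<omega>\<in>space M. X \<omega> \<le> s \<and> t < Y \<omega>}"
    if [measurable]: "random_variable borel X" "random_variable borel Y" for X Y :: "'a \<Rightarrow> real" and s t
  proof -
    have "prob {\<omega>\<in>space M. X \<omega> \<le> s} \<le> prob ({\<omega>\<in>space M. X \<omega> \<le> s \<and> t < Y \<omega>} \<union> {\<omega>\<in>space M. Y \<omega> \<le> t})"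
      by (intro finite_measure_mono) auto
    also have "\<dots> \<le> prob {\<omega>\<in>space M. X \<omega> \<le> s \<and> t < Y \<omega>} + prob {\<omega>\<in>space M. Y \<omega> \<le> t}"
      by (intro measure_Un_le) auto
    finally have "cdf (distr M borel X) s - cdf (distr M borel Y) t \<le> prob {\<omega>\<in>space M. X \<omega> \<le> s \<and> t < Y \<omega>}"
      by (simp add: cdf_def measure_distr vimage_def Int_def conj_commute)
    then show ?thesis
      by (simp add: emeasure_eq_measure ennreal_leI)
  qed
  show ?thesis
    unfolding nn_integral_power2_diff[OF assms] hoeffding_cost_def
    by (intro add_mono mult_left_mono nn_integral_mono) (auto simp: *)
qed

text \<open>The uniform law in the form in which the facts on \<open>cdf_distribution\<close> use
  it, so that the pseudoinverse \<open>I\<close> of a cdf serves as a version of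
  \<open>quantile\<close>.\<close>

definition unit_interval :: "real measure" where
  "unit_interval = restrict_space lborel {0<..<1}"

lemma space_unit_interval [simp]: "space unit_interval = {0<..<1}"
  by (simp add: unit_interval_def space_restrict_space)

interpretation unit_interval: prob_space unit_interval
  by (auto simp add: unit_interval_def emeasure_restrict_space space_restrict_space intro!: prob_spaceI)

lemma P2_real_distribution: "\<mu> \<in> P2 \<Longrightarrow> real_distribution \<mu>"
  by (simp add: P2_def)

lemma measurable_quantile [measurable]:
  assumes "real_distribution \<mu>"
  shows "quantile \<mu> \<in> borel_measurable unit_interval"
proof -
  interpret cdf_distribution \<mu> using assms by (simp add: cdf_distribution_def)
  have "I \<in> borel_measurable unit_interval"
    using measurable_CI unfolding unit_interval_def
    by (subst measurable_cong_sets[OF sets_restrict_space_cong refl, of _ borel]) auto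
  then show ?thesis
    by (subst measurable_cong[of _ _ I]) (auto simp: quantile_def)
qed

text \<open>The Galois connection that right-continuity of a cdf yields. It turns events about
  quantile functions into intervals of u.\<close>

lemma quantile_le_iff:
  assumes "real_distribution \<mu>" "0 < u" "u < 1"
  shows "quantile \<mu> u \<le> x \<longleftrightarrow> u \<le> cdf \<mu> x"
proof -
  interpret cdf_distribution \<mu> using assms by (simp add: cdf_distribution_def)
  show ?thesis
    using assms pseudoinverse[of u x] by (simp add: quantile_def)
qed

lemma distr_quantile:
  assumes "real_distribution \<mu>"
  shows "distr unit_interval borel (quantile \<mu>) = \<mu>"
proof -
  interpret cdf_distribution \<mu> using assms by (simp add: cdf_distribution_def)
  have "distr unit_interval borel (quantile \<mu>) = distr unit_interval borel I"
    by (intro distr_cong) (auto simp: quantile_def)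
  then show ?thesis
    using distr_I_eq_M by (simp add: unit_interval_def)
qed

text \<open>The case of equality in \<open>hoeffding_cost_le\<close>: both functions are evaluated
  at the same u, so the event is an interval whose length is exactly the positive part of the
  difference of the cdfs.\<close>

lemma nn_integral_quantile_diff:
  assumes "real_distribution \<mu>" "real_distribution \<nu>"
  shows "(\<integral>\<^sup>+u. ennreal ((quantile \<mu> u - quantile \<nu> u)\<^sup>2) \<partial>unit_interval)
    = hoeffding_cost (cdf \<mu>) (cdf \<nu>) + hoeffding_cost (cdf \<nu>) (cdf \<mu>)"
proof -
  have *: "emeasure unit_interval {u\<in>space unit_interval. quantile \<mu> u \<le> s \<and> t < quantile \<nu> u}
      = ennreal (cdf \<mu> s - cdf \<nu> t)"
    if "real_distribution \<mu>" "real_distribution \<nu>" for \<mu> \<nu> s t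
  proof -
    interpret \<mu>: real_distribution \<mu> by fact
    interpret \<nu>: real_distribution \<nu> by fact
    have "{u\<in>space unit_interval. quantile \<mu> u \<le> s \<and> t < quantile \<nu> u} = {cdf \<nu> t<..cdf \<mu> s} \<inter> {0<..<1}"
      using that by (auto simp: quantile_le_iff not_le[symmetric])
    then have "emeasure unit_interval {u\<in>space unit_interval. quantile \<mu> u \<le> s \<and> t < quantile \<nu> u}
       = emeasure lborel ({cdf \<nu> t<..cdf \<mu> s} \<inter> {0<..<1})"
      by (simp add: unit_interval_def emeasure_restrict_space)
    \<comment> \<open>The cdf values lie in [0,1], so intersecting with the open unit interval can
      remove only the endpoint 1.\<close>
    also have "\<dots> = emeasure lborel {cdf \<nu> t<..cdf \<mu> s}"
      using AE_lborel_singleton[of 1] \<mu>.cdf_bounded_prob[of s] \<nu>.cdf_nonneg[of t]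
      by (intro emeasure_eq_AE) (auto elim: eventually_mono)
    also have "\<dots> = ennreal (cdf \<mu> s - cdf \<nu> t)"
      by (cases "cdf \<nu> t \<le> cdf \<mu> s") (auto simp: ennreal_neg)
    finally show ?thesis .
  qed
  show ?thesis
    unfolding unit_interval.nn_integral_power2_diff[OF assms[THEN measurable_quantile]]
      hoeffding_cost_def *[OF assms] *[OF assms(2,1)] ..
qed

lemma (in prob_space) coupling_of_random_variables:
  assumes [measurable]: "random_variable borel X" "random_variable borel Y"
  shows "distr M (borel \<Otimes>\<^sub>M borel) (\<lambda>\<omega>. (X \<omega>, Y \<omega>)) \<in> couplings (distr M borel X) (distr M borel Y)"
  unfolding couplings_def by (auto simp: prob_space_distr distr_distr comp_def)

lemma INF_couplings_eq:
  assumes "real_distribution \<mu>" "real_distribution \<nu>"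
  shows "(INF \<pi> \<in> couplings \<mu> \<nu>. \<integral>\<^sup>+ (x, y). ennreal (\<bar>x - y\<bar>\<^sup>2) \<partial>\<pi>)
    = (\<integral>\<^sup>+u. ennreal ((quantile \<mu> u - quantile \<nu> u)\<^sup>2) \<partial>unit_interval)"
proof (rule antisym)
  have [measurable]: "quantile \<mu> \<in> borel_measurable unit_interval" "quantile \<nu> \<in> borel_measurable unit_interval"
    using assms by auto
  let ?\<pi> = "distr unit_interval (borel \<Otimes>\<^sub>M borel) (\<lambda>u. (quantile \<mu> u, quantile \<nu> u))"
  have "?\<pi> \<in> couplings \<mu> \<nu>"
    using unit_interval.coupling_of_random_variables[of "quantile \<mu>" "quantile \<nu>"] assms
    by (simp add: distr_quantile)
  then have "(INF \<pi> \<in> couplings \<mu> \<nu>. \<integral>\<^sup>+ (x, y). ennreal (\<bar>x - y\<bar>\<^sup>2) \<partial>\<pi>) \<le> (\<integral>\<^sup>+ (x, y). ennreal (\<bar>x - y\<bar>\<^sup>2) \<partial>?\<pi>)"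
    by (rule INF_lower)
  also have "\<dots> = (\<integral>\<^sup>+u. ennreal ((quantile \<mu> u - quantile \<nu> u)\<^sup>2) \<partial>unit_interval)"
    by (simp add: nn_integral_distr)
  finally show "(INF \<pi> \<in> couplings \<mu> \<nu>. \<integral>\<^sup>+ (x, y). ennreal (\<bar>x - y\<bar>\<^sup>2) \<partial>\<pi>)
    \<le> (\<integral>\<^sup>+u. ennreal ((quantile \<mu> u - quantile \<nu> u)\<^sup>2) \<partial>unit_interval)" .
next
  show "(\<integral>\<^sup>+u. ennreal ((quantile \<mu> u - quantile \<nu> u)\<^sup>2) \<partial>unit_interval)
    \<le> (INF \<pi> \<in> couplings \<mu> \<nu>. \<integral>\<^sup>+ (x, y). ennreal (\<bar>x - y\<bar>\<^sup>2) \<partial>\<pi>)"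
  proof (rule INF_greatest)
    fix \<pi> assume \<pi>: "\<pi> \<in> couplings \<mu> \<nu>"
    then interpret \<pi>: prob_space \<pi> by (simp add: couplings_def)
    have [measurable_cong]: "sets \<pi> = sets (borel \<Otimes>\<^sub>M borel)"
      and d: "distr \<pi> borel fst = \<mu>" "distr \<pi> borel snd = \<nu>"
      using \<pi> by (auto simp: couplings_def)
    show "(\<integral>\<^sup>+u. ennreal ((quantile \<mu> u - quantile \<nu> u)\<^sup>2) \<partial>unit_interval) \<le> (\<integral>\<^sup>+ (x, y). ennreal (\<bar>x - y\<bar>\<^sup>2) \<partial>\<pi>)"
      using \<pi>.hoeffding_cost_le[of fst snd] assms
      by (simp add: nn_integral_quantile_diff d split_beta')
  qed
qed

text \<open>Outside \<open>P2\<close> the integral may diverge; both sides are then 0, by the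
  conventions for \<open>enn2real\<close> and for the Bochner integral.\<close>

lemma W2_eq_quantile:
  assumes "real_distribution \<mu>" "real_distribution \<nu>"
  shows "W2 \<mu> \<nu> = sqrt (\<integral>u. (quantile \<mu> u - quantile \<nu> u)\<^sup>2 \<partial>unit_interval)"
  unfolding W2_def INF_couplings_eq[OF assms] using assms
  by (subst integral_eq_nn_integral) auto

text \<open>The source of upper bounds for variables that are not quantile functions, such as almost
  everywhere limits and Skorohod's representatives. Integrability excludes a right-hand side that is
  0 only by the convention for divergent integrals.\<close>

lemma W2_le_random_variables:
  assumes "prob_space M" and [measurable]: "X \<in> borel_measurable M" "Y \<in> borel_measurable M"
    and "integrable M (\<lambda>\<omega>. (X \<omega> - Y \<omega>)\<^sup>2)"
  shows "W2 (distr M borel X) (distr M borel Y) \<le> sqrt (\<integral>\<omega>. (X \<omega> - Y \<omega>)\<^sup>2 \<partial>M)"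
proof -
  interpret prob_space M by fact
  have "(INF \<pi> \<in> couplings (distr M borel X) (distr M borel Y). \<integral>\<^sup>+ (x, y). ennreal (\<bar>x - y\<bar>\<^sup>2) \<partial>\<pi>)
      \<le> (\<integral>\<^sup>+ (x, y). ennreal (\<bar>x - y\<bar>\<^sup>2) \<partial>distr M (borel \<Otimes>\<^sub>M borel) (\<lambda>\<omega>. (X \<omega>, Y \<omega>)))"
    by (intro INF_lower coupling_of_random_variables) auto
  also have "\<dots> = (\<integral>\<^sup>+\<omega>. ennreal ((X \<omega> - Y \<omega>)\<^sup>2) \<partial>M)"
    by (simp add: nn_integral_distr)
  also have "\<dots> = ennreal (\<integral>\<omega>. (X \<omega> - Y \<omega>)\<^sup>2 \<partial>M)"
    using assms by (intro nn_integral_eq_integral) auto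
  finally show ?thesis
    unfolding W2_def by (intro real_sqrt_le_mono enn2real_leI) auto
qed

text \<open>The locale \<open>Metric_space\<close> demands symmetry on the whole type. Swapping the
  coordinates of a coupling gives it there, whereas the quantile formula covers real distributions
  only.\<close>

lemma W2_commute: "W2 \<mu> \<nu> = W2 \<nu> \<mu>"
proof -
  have *: "(INF \<pi> \<in> couplings \<nu> \<mu>. \<integral>\<^sup>+ (x, y). ennreal (\<bar>x - y\<bar>\<^sup>2) \<partial>\<pi>)
      \<le> (INF \<pi> \<in> couplings \<mu> \<nu>. \<integral>\<^sup>+ (x, y). ennreal (\<bar>x - y\<bar>\<^sup>2) \<partial>\<pi>)" for \<mu> \<nu>
  proof (rule INF_greatest)
    fix \<pi> assume \<pi>: "\<pi> \<in> couplings \<mu> \<nu>"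
    then interpret \<pi>: prob_space \<pi> by (simp add: couplings_def)
    have [measurable_cong]: "sets \<pi> = sets (borel \<Otimes>\<^sub>M borel)"
      and d: "distr \<pi> borel fst = \<mu>" "distr \<pi> borel snd = \<nu>"
      using \<pi> by (auto simp: couplings_def)
    have "(INF \<pi> \<in> couplings \<nu> \<mu>. \<integral>\<^sup>+ (x, y). ennreal (\<bar>x - y\<bar>\<^sup>2) \<partial>\<pi>)
       \<le> (\<integral>\<^sup>+ (x, y). ennreal (\<bar>x - y\<bar>\<^sup>2) \<partial>distr \<pi> (borel \<Otimes>\<^sub>M borel) (\<lambda>p. (snd p, fst p)))"
      using \<pi>.coupling_of_random_variables[of snd fst] by (intro INF_lower) (simp add: d)
    also have "\<dots> = (\<integral>\<^sup>+ (x, y). ennreal (\<bar>x - y\<bar>\<^sup>2) \<partial>\<pi>)"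
      by (simp add: nn_integral_distr split_beta' power2_commute)
    finally show "(INF \<pi> \<in> couplings \<nu> \<mu>. \<integral>\<^sup>+ (x, y). ennreal (\<bar>x - y\<bar>\<^sup>2) \<partial>\<pi>)
       \<le> (\<integral>\<^sup>+ (x, y). ennreal (\<bar>x - y\<bar>\<^sup>2) \<partial>\<pi>)" .
  qed
  show ?thesis
    unfolding W2_def antisym[OF *[of \<nu> \<mu>] *[of \<mu> \<nu>]] ..
qed

subsection \<open>Projections in the Wasserstein metric\<close>

lemma integrable_mult_square_integrable:
  fixes f g :: "'a \<Rightarrow> real"
  assumes [measurable]: "f \<in> borel_measurable M" "g \<in> borel_measurable M"
    and "integrable M (\<lambda>x. (f x)\<^sup>2)" "integrable M (\<lambda>x. (g x)\<^sup>2)"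
  shows "integrable M (\<lambda>x. f x * g x)"
proof (rule Bochner_Integration.integrable_bound)
  show "integrable M (\<lambda>x. (f x)\<^sup>2 + (g x)\<^sup>2)"
    using assms by simp
  have "\<bar>a * b\<bar> \<le> a\<^sup>2 + b\<^sup>2" for a b :: real
    using sum_squares_bound[of "\<bar>a\<bar>" "\<bar>b\<bar>"] mult_nonneg_nonneg[OF abs_ge_zero[of a] abs_ge_zero[of b]]
    unfolding abs_mult power2_abs by linarith
  then show "AE x in M. norm (f x * g x) \<le> norm ((f x)\<^sup>2 + (g x)\<^sup>2)"
    by (simp add: abs_of_nonneg)
qed simp

lemma integrable_add_square:
  fixes f g :: "'a \<Rightarrow> real"
  assumes [measurable]: "f \<in> borel_measurable M" "g \<in> borel_measurable M"
    and "integrable M (\<lambda>x. (f x)\<^sup>2)" "integrable M (\<lambda>x. (g x)\<^sup>2)"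
  shows "integrable M (\<lambda>x. (f x + g x)\<^sup>2)"
  using assms integrable_mult_square_integrable[OF assms] by (simp add: power2_sum mult.assoc)

lemma integrable_diff_square:
  fixes f g :: "'a \<Rightarrow> real"
  assumes [measurable]: "f \<in> borel_measurable M" "g \<in> borel_measurable M"
    and "integrable M (\<lambda>x. (f x)\<^sup>2)" "integrable M (\<lambda>x. (g x)\<^sup>2)"
  shows "integrable M (\<lambda>x. (f x - g x)\<^sup>2)"
  using assms integrable_mult_square_integrable[OF assms] by (simp add: power2_diff mult.assoc)

lemma Cauchy_Schwarz_integral:
  fixes f g :: "'a \<Rightarrow> real"
  assumes [measurable]: "f \<in> borel_measurable M" "g \<in> borel_measurable M"
    and i: "integrable M (\<lambda>x. (f x)\<^sup>2)" "integrable M (\<lambda>x. (g x)\<^sup>2)"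
  shows "(\<integral>x. f x * g x \<partial>M) \<le> sqrt (\<integral>x. (f x)\<^sup>2 \<partial>M) * sqrt (\<integral>x. (g x)\<^sup>2 \<partial>M)"
proof -
  have *: "integrable M (\<lambda>x. \<bar>f x\<bar> * \<bar>g x\<bar>)"
    using integrable_abs[OF integrable_mult_square_integrable[OF assms]] by (simp add: abs_mult)
  have "ennreal ((\<integral>x. \<bar>f x\<bar> * \<bar>g x\<bar> \<partial>M)\<^sup>2) = (\<integral>\<^sup>+x. ennreal \<bar>f x\<bar> * ennreal \<bar>g x\<bar> \<partial>M)\<^sup>2"
    using nn_integral_eq_integral[OF *] by (simp add: ennreal_mult' ennreal_power)
  also have "\<dots> \<le> (\<integral>\<^sup>+x. (ennreal \<bar>f x\<bar>)\<^sup>2 \<partial>M) * (\<integral>\<^sup>+x. (ennreal \<bar>g x\<bar>)\<^sup>2 \<partial>M)"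
    by (intro Cauchy_Schwarz_nn_integral) auto
  also have "\<dots> = ennreal ((\<integral>x. (f x)\<^sup>2 \<partial>M) * (\<integral>x. (g x)\<^sup>2 \<partial>M))"
    using i by (simp add: ennreal_power nn_integral_eq_integral ennreal_mult)
  finally have "(\<integral>x. \<bar>f x\<bar> * \<bar>g x\<bar> \<partial>M)\<^sup>2 \<le> (\<integral>x. (f x)\<^sup>2 \<partial>M) * (\<integral>x. (g x)\<^sup>2 \<partial>M)"
    by (simp add: ennreal_le_iff)
  then have "(\<integral>x. \<bar>f x\<bar> * \<bar>g x\<bar> \<partial>M) \<le> sqrt (\<integral>x. (f x)\<^sup>2 \<partial>M) * sqrt (\<integral>x. (g x)\<^sup>2 \<partial>M)"
    by (simp add: real_le_rsqrt flip: real_sqrt_mult)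
  moreover have "(\<integral>x. f x * g x \<partial>M) \<le> (\<integral>x. \<bar>f x\<bar> * \<bar>g x\<bar> \<partial>M)"
    using * integrable_mult_square_integrable[OF assms]
    by (intro integral_mono) (auto simp flip: abs_mult)
  ultimately show ?thesis by linarith
qed

lemma Minkowski_integral_square:
  fixes f g :: "'a \<Rightarrow> real"
  assumes [measurable]: "f \<in> borel_measurable M" "g \<in> borel_measurable M"
    and i: "integrable M (\<lambda>x. (f x)\<^sup>2)" "integrable M (\<lambda>x. (g x)\<^sup>2)"
  shows "sqrt (\<integral>x. (f x + g x)\<^sup>2 \<partial>M) \<le> sqrt (\<integral>x. (f x)\<^sup>2 \<partial>M) + sqrt (\<integral>x. (g x)\<^sup>2 \<partial>M)"
proof -
  let ?a = "sqrt (\<integral>x. (f x)\<^sup>2 \<partial>M)" and ?b = "sqrt (\<integral>x. (g x)\<^sup>2 \<partial>M)"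
  have "(\<integral>x. (f x + g x)\<^sup>2 \<partial>M) = (\<integral>x. (f x)\<^sup>2 \<partial>M) + (\<integral>x. (g x)\<^sup>2 \<partial>M) + 2 * (\<integral>x. f x * g x \<partial>M)"
    using integrable_mult_square_integrable[OF assms] i by (simp add: power2_sum mult.assoc)
  also have "\<dots> \<le> ?a\<^sup>2 + ?b\<^sup>2 + 2 * (?a * ?b)"
    using Cauchy_Schwarz_integral[OF assms] by simp
  also have "\<dots> = (?a + ?b)\<^sup>2"
    by (simp add: power2_sum)
  finally show ?thesis
    by (intro real_le_lsqrt) auto
qed

lemma (in prob_space) integral_abs_le_sqrt:
  fixes f :: "'a \<Rightarrow> real"
  assumes [measurable]: "f \<in> borel_measurable M" and i: "integrable M (\<lambda>x. (f x)\<^sup>2)"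
  shows "(\<integral>x. \<bar>f x\<bar> \<partial>M) \<le> sqrt (\<integral>x. (f x)\<^sup>2 \<partial>M)"
  using Cauchy_Schwarz_integral[of "\<lambda>x. \<bar>f x\<bar>" M "\<lambda>_. 1"] i by (simp add: prob_space)

text \<open>Fatou's lemma carries a bound on second moments to an almost everywhere limit without
  convergence in mean. This is used on a minimizing sequence, of which a subsequence converges
  pointwise.\<close>

lemma Fatou_power2:
  fixes f :: "'a \<Rightarrow> real"
  assumes [measurable]: "\<And>n. g n \<in> borel_measurable M" "f \<in> borel_measurable M"
    and lim: "AE x in M. (\<lambda>n. g n x) \<longlonglongrightarrow> f x"
    and i: "\<And>n. integrable M (\<lambda>x. (g n x)\<^sup>2)"
    and c: "\<forall>\<^sub>F n in sequentially. (\<integral>x. (g n x)\<^sup>2 \<partial>M) \<le> c"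
  shows "integrable M (\<lambda>x. (f x)\<^sup>2)" "(\<integral>x. (f x)\<^sup>2 \<partial>M) \<le> c"
proof -
  have "(\<integral>\<^sup>+x. ennreal ((f x)\<^sup>2) \<partial>M) = (\<integral>\<^sup>+x. liminf (\<lambda>n. ennreal ((g n x)\<^sup>2)) \<partial>M)"
    using lim
  proof (intro nn_integral_cong_AE, eventually_elim)
    fix x assume "(\<lambda>n. g n x) \<longlonglongrightarrow> f x"
    then have "(\<lambda>n. ennreal ((g n x)\<^sup>2)) \<longlonglongrightarrow> ennreal ((f x)\<^sup>2)"
      by (intro tendsto_ennrealI tendsto_intros)
    then show "ennreal ((f x)\<^sup>2) = liminf (\<lambda>n. ennreal ((g n x)\<^sup>2))"
      using lim_imp_Liminf[of sequentially] by fastforce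
  qed
  also have "\<dots> \<le> liminf (\<lambda>n. \<integral>\<^sup>+x. ennreal ((g n x)\<^sup>2) \<partial>M)"
    by (rule nn_integral_liminf) auto
  also have "\<dots> \<le> limsup (\<lambda>n. \<integral>\<^sup>+x. ennreal ((g n x)\<^sup>2) \<partial>M)"
    by (rule Liminf_le_Limsup) simp
  also have "\<dots> \<le> ennreal c"
    using c by (intro Limsup_bounded) (auto elim!: eventually_mono simp: nn_integral_eq_integral i ennreal_leI)
  finally have le: "(\<integral>\<^sup>+x. ennreal ((f x)\<^sup>2) \<partial>M) \<le> ennreal c" .
  then show "integrable M (\<lambda>x. (f x)\<^sup>2)"
    by (intro integrableI_nonneg) (auto intro: le_less_trans)
  \<comment> \<open>\<open>ennreal c\<close> would disguise a negative \<open>c\<close> as 0; an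
    index at which the bound holds shows that \<open>c\<close> is nonnegative.\<close>
  obtain n where "(\<integral>x. (g n x)\<^sup>2 \<partial>M) \<le> c"
    using eventually_happens[OF c] by auto
  then have "0 \<le> c"
    by (rule order_trans[rotated]) simp
  then show "(\<integral>x. (f x)\<^sup>2 \<partial>M) \<le> c"
    using le by (subst integral_eq_nn_integral) (auto intro: enn2real_leI)
qed

section \<open>The metric space \<open>P2\<close>\<close>

lemma P2_measurable_quantile [measurable]: "\<mu> \<in> P2 \<Longrightarrow> quantile \<mu> \<in> borel_measurable unit_interval"
  by (simp add: P2_def)

lemma P2_quantile_square_integrable:
  assumes "\<mu> \<in> P2"
  shows "integrable unit_interval (\<lambda>u. (quantile \<mu> u)\<^sup>2)"
proof -
  have "integrable (distr unit_interval borel (quantile \<mu>)) (\<lambda>x. x\<^sup>2)"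
    using assms by (simp add: P2_def distr_quantile)
  then show ?thesis
    using assms by (subst (asm) integrable_distr_eq) auto
qed

lemma distr_P2:
  assumes "prob_space M" and [measurable]: "X \<in> borel_measurable M" and "integrable M (\<lambda>\<omega>. (X \<omega>)\<^sup>2)"
  shows "distr M borel X \<in> P2"
proof -
  interpret prob_space M by fact
  show ?thesis
    using assms by (simp add: P2_def integrable_distr_eq real_distribution_distr)
qed

lemma P2_integrable_quantile_diff_mult:
  assumes "\<mu> \<in> P2" "\<nu> \<in> P2" "\<mu>' \<in> P2" "\<nu>' \<in> P2"
  shows "integrable unit_interval (\<lambda>u. (quantile \<mu> u - quantile \<nu> u) * (quantile \<mu>' u - quantile \<nu>' u))"
  using assms
  by (intro integrable_mult_square_integrable integrable_diff_square) (auto simp: P2_quantile_square_integrable)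

lemma P2_integrable_quantile_diff_square:
  assumes "\<mu> \<in> P2" "\<nu> \<in> P2"
  shows "integrable unit_interval (\<lambda>u. (quantile \<mu> u - quantile \<nu> u)\<^sup>2)"
  using P2_integrable_quantile_diff_mult[of \<mu> \<nu> \<mu> \<nu>] assms by (simp add: power2_eq_square)

lemma W2_nonneg: "0 \<le> W2 \<mu> \<nu>"
  by (simp add: W2_def)

lemma W2_power2:
  assumes "\<mu> \<in> P2" "\<nu> \<in> P2"
  shows "(W2 \<mu> \<nu>)\<^sup>2 = (\<integral>u. (quantile \<mu> u - quantile \<nu> u)\<^sup>2 \<partial>unit_interval)"
  using assms by (simp add: W2_eq_quantile P2_def)

lemma W2_triangle:
  assumes "\<mu> \<in> P2" "\<nu> \<in> P2" "\<rho> \<in> P2"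
  shows "W2 \<mu> \<rho> \<le> W2 \<mu> \<nu> + W2 \<nu> \<rho>"
  using assms Minkowski_integral_square[of "\<lambda>u. quantile \<mu> u - quantile \<nu> u" unit_interval "\<lambda>u. quantile \<nu> u - quantile \<rho> u"]
  by (simp add: W2_eq_quantile P2_real_distribution P2_integrable_quantile_diff_square)

text \<open>Almost everywhere equality of the quantile functions suffices, because each measure is
  the law of its quantile function.\<close>

lemma W2_eq_0_iff:
  assumes "\<mu> \<in> P2" "\<nu> \<in> P2"
  shows "W2 \<mu> \<nu> = 0 \<longleftrightarrow> \<mu> = \<nu>"
proof
  assume "W2 \<mu> \<nu> = 0"
  then have "(\<integral>u. (quantile \<mu> u - quantile \<nu> u)\<^sup>2 \<partial>unit_interval) = 0"
    using assms by (simp flip: W2_power2)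
  then have "AE u in unit_interval. quantile \<mu> u = quantile \<nu> u"
    using assms by (simp add: integral_nonneg_eq_0_iff_AE P2_integrable_quantile_diff_square)
  then have "distr unit_interval borel (quantile \<mu>) = distr unit_interval borel (quantile \<nu>)"
    using assms by (intro distr_cong_AE) auto
  then show "\<mu> = \<nu>"
    using assms by (simp add: distr_quantile P2_real_distribution)
qed (use assms in \<open>simp add: W2_eq_quantile P2_real_distribution\<close>)

lemma Metric_space_W2: "Metric_space P2 W2"
  by unfold_locales (auto simp: W2_nonneg W2_commute W2_eq_0_iff W2_triangle)

section \<open>Existence, uniqueness and nonexpansiveness of the projection\<close>

lemma W2_closed_sequentially:
  assumes "W2_closed F" "\<And>n. \<nu> n \<in> F" "p \<in> P2" "(\<lambda>n. W2 p (\<nu> n)) \<longlonglongrightarrow> 0"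
  shows "p \<in> F"
proof (rule ccontr)
  interpret Metric_space P2 W2 by (rule Metric_space_W2)
  assume "p \<notin> F"
  moreover have F: "F \<subseteq> P2" "\<And>x. x \<in> P2 - F \<Longrightarrow> \<exists>r>0. disjnt F (mball x r)"
    using assms(1) unfolding W2_closed_def closedin_metric by blast+
  ultimately obtain r where "r > 0" "disjnt F (mball p r)"
    using assms(3) by blast
  moreover from \<open>r > 0\<close> obtain n where "W2 p (\<nu> n) < r"
    using order_tendstoD(2)[OF assms(4)] eventually_happens[of _ sequentially] by fastforce
  ultimately show False
    using assms(2,3) F(1) by (auto simp: disjnt_iff subset_iff)
qed

lemma displacement_convexD:
  assumes "displacement_convex F" "\<mu> \<in> F" "\<nu> \<in> F" "0 \<le> t" "t \<le> 1"
  obtains \<rho> where "\<rho> \<in> F" "\<And>u. u \<in> {0<..<1} \<Longrightarrow> quantile \<rho> u = (1 - t) * quantile \<mu> u + t * quantile \<nu> u"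
proof -
  have "(\<lambda>u\<in>{0<..<1}. (1 - t) * quantile \<mu> u + t * quantile \<nu> u) \<in> quantile ` F"
    using assms(1)[unfolded displacement_convex_def, rule_format, OF imageI[OF assms(2)] imageI[OF assms(3)], of "1 - t" t] assms(4,5)
    by simp
  then obtain \<rho> where "\<rho> \<in> F" "quantile \<rho> = (\<lambda>u\<in>{0<..<1}. (1 - t) * quantile \<mu> u + t * quantile \<nu> u)"
    by auto
  then show ?thesis
    by (intro that[of \<rho>]) auto
qed

text \<open>The Hilbert space argument: by the parallelogram law a minimizing sequence in a convex
  set is Cauchy. Displacement convexity supplies the midpoints, and closedness is applied to the law
  of the limit function.\<close>

lemma W2_minimizer_exists:
  assumes "F \<noteq> {}" and F: "F \<subseteq> P2" and conv: "displacement_convex F" and closed: "W2_closed F"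
    and \<mu>: "\<mu> \<in> P2"
  obtains p where "is_arg_min (\<lambda>\<nu>. W2 \<nu> \<mu>) (\<lambda>\<nu>. \<nu> \<in> F) p"
proof -
  define J where "J \<nu> = (\<integral>u. (quantile \<nu> u - quantile \<mu> u)\<^sup>2 \<partial>unit_interval)" for \<nu>
  define d where "d = (INF \<nu>\<in>F. J \<nu>)"
  have "bdd_below (J ` F)"
    by (intro bdd_belowI[of _ 0]) (auto simp: J_def)
  then have d_le: "d \<le> J \<nu>" if "\<nu> \<in> F" for \<nu>
    using that by (auto simp: d_def intro: cINF_lower)
  have "\<exists>\<nu>\<in>F. J \<nu> < d + 1 / Suc n" for n
    using \<open>F \<noteq> {}\<close> \<open>bdd_below (J ` F)\<close> cINF_less_iff[of F J "d + 1 / Suc n"] by (simp add: d_def)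
  then obtain \<nu> where \<nu>F: "\<And>n. \<nu> n \<in> F" and \<nu>J: "\<And>n. J (\<nu> n) < d + 1 / Suc n"
    by metis
  have \<nu>P: "\<nu> n \<in> P2" for n
    using \<nu>F F by auto
  have [measurable]: "quantile (\<nu> n) \<in> borel_measurable unit_interval" "quantile \<mu> \<in> borel_measurable unit_interval" for n
    using \<nu>P \<mu> by auto
  \<comment> \<open>The midpoint \<rho> of \<alpha> and \<beta> is a competitor, so
    \<open>J \<rho>\<close> is at least \<open>d\<close>; the parallelogram law around
    \<open>quantile \<mu>\<close> turns this into closeness of \<alpha> and \<beta>.\<close>
  have parallelogram: "(\<integral>u. (quantile \<alpha> u - quantile \<beta> u)\<^sup>2 \<partial>unit_interval) \<le> 2 * J \<alpha> + 2 * J \<beta> - 4 * d"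
    if ab: "\<alpha> \<in> F" "\<beta> \<in> F" for \<alpha> \<beta>
  proof -
    obtain \<rho> where \<rho>: "\<rho> \<in> F" "\<And>u. u \<in> {0<..<1} \<Longrightarrow> quantile \<rho> u = (1 - 1 / 2) * quantile \<alpha> u + 1 / 2 * quantile \<beta> u"
      using displacement_convexD[OF conv ab, of "1 / 2"] by auto
    have P: "\<alpha> \<in> P2" "\<beta> \<in> P2" "\<rho> \<in> P2"
      using ab \<rho> F by auto
    have "(\<integral>u. (quantile \<alpha> u - quantile \<beta> u)\<^sup>2 \<partial>unit_interval) =
      (\<integral>u. 2 * (quantile \<alpha> u - quantile \<mu> u)\<^sup>2 + 2 * (quantile \<beta> u - quantile \<mu> u)\<^sup>2 - 4 * (quantile \<rho> u - quantile \<mu> u)\<^sup>2 \<partial>unit_interval)"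
    proof (intro Bochner_Integration.integral_cong refl)
      fix u assume "u \<in> space unit_interval"
      then have *: "quantile \<rho> u = (1 - 1 / 2) * quantile \<alpha> u + 1 / 2 * quantile \<beta> u"
        using \<rho>(2) by simp
      show "(quantile \<alpha> u - quantile \<beta> u)\<^sup>2 = 2 * (quantile \<alpha> u - quantile \<mu> u)\<^sup>2
          + 2 * (quantile \<beta> u - quantile \<mu> u)\<^sup>2 - 4 * (quantile \<rho> u - quantile \<mu> u)\<^sup>2"
        unfolding * by (simp add: power2_eq_square field_simps)
    qed
    also have "\<dots> = 2 * J \<alpha> + 2 * J \<beta> - 4 * J \<rho>"
      using P \<mu> by (simp add: J_def P2_integrable_quantile_diff_square)
    also have "\<dots> \<le> 2 * J \<alpha> + 2 * J \<beta> - 4 * d"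
      using d_le[OF \<rho>(1)] by simp
    finally show ?thesis .
  qed
  \<comment> \<open>The excesses over \<open>d\<close> contribute 2/(n+1) + 2/(m+1), and the second
    term is at most the first.\<close>
  have dist: "(\<integral>u. (quantile (\<nu> n) u - quantile (\<nu> m) u)\<^sup>2 \<partial>unit_interval) \<le> 4 / Suc n" if "n \<le> m" for n m
  proof -
    have "1 / real (Suc m) \<le> 1 / real (Suc n)"
      using that by (simp add: frac_le)
    then show ?thesis
      using parallelogram[OF \<nu>F[of n] \<nu>F[of m]] \<nu>J[of n] \<nu>J[of m] by simp
  qed
  \<comment> \<open>The subsequence theorem used below is about L^1; on a probability space the L^2
    norm dominates the L^1 norm.\<close>
  have cauchy: "\<exists>N. \<forall>i\<ge>N. \<forall>j\<ge>N. (\<integral>u. norm (quantile (\<nu> i) u - quantile (\<nu> j) u) \<partial>unit_interval) < e" if "e > 0" for e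
  proof -
    obtain N where N: "4 / e\<^sup>2 < real (Suc N)"
      by (meson reals_Archimedean2 less_trans of_nat_less_iff lessI)
    have *: "(\<integral>u. norm (quantile (\<nu> i) u - quantile (\<nu> j) u) \<partial>unit_interval) < e" if "N \<le> i" "i \<le> j" for i j
    proof -
      have "(\<integral>u. (quantile (\<nu> i) u - quantile (\<nu> j) u)\<^sup>2 \<partial>unit_interval) \<le> 4 / Suc i"
        using dist that by blast
      also have "\<dots> \<le> 4 / Suc N"
        using that by (simp add: frac_le)
      also have "\<dots> < e\<^sup>2"
        using N \<open>e > 0\<close> by (simp add: field_simps)
      finally have "sqrt (\<integral>u. (quantile (\<nu> i) u - quantile (\<nu> j) u)\<^sup>2 \<partial>unit_interval) < e"
        using \<open>e > 0\<close> by (intro real_less_lsqrt) auto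
      moreover have "(\<integral>u. norm (quantile (\<nu> i) u - quantile (\<nu> j) u) \<partial>unit_interval)
          \<le> sqrt (\<integral>u. (quantile (\<nu> i) u - quantile (\<nu> j) u)\<^sup>2 \<partial>unit_interval)"
        using \<nu>P by (simp add: unit_interval.integral_abs_le_sqrt P2_integrable_quantile_diff_square)
      ultimately show ?thesis by simp
    qed
    have "(\<integral>u. norm (quantile (\<nu> i) u - quantile (\<nu> j) u) \<partial>unit_interval) < e" if "N \<le> i" "N \<le> j" for i j
      using *[of i j] *[of j i] that by (cases "i \<le> j") (auto simp: abs_minus_commute)
    then show ?thesis by blast
  qed
  have int: "integrable unit_interval (quantile (\<nu> n))" for n
    using unit_interval.square_integrable_imp_integrable[of "quantile (\<nu> n)"] P2_quantile_square_integrable[OF \<nu>P] by simp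
  obtain r where r: "strict_mono r" and C: "AE u in unit_interval. Cauchy (\<lambda>i. quantile (\<nu> (r i)) u)"
    by (rule cauchy_L1_AE_cauchy_subseq[of unit_interval "\<lambda>n. quantile (\<nu> n)", OF int cauchy])
  define f where "f u = lim (\<lambda>i. quantile (\<nu> (r i)) u)" for u
  have [measurable]: "f \<in> borel_measurable unit_interval"
    unfolding f_def by measurable
  have lim: "AE u in unit_interval. (\<lambda>i. quantile (\<nu> (r i)) u) \<longlonglongrightarrow> f u"
    using C by eventually_elim (simp add: f_def Cauchy_convergent convergent_LIMSEQ_iff[symmetric])
  have r_le: "n \<le> r n" for n
    using r by (simp add: seq_suble)
  \<comment> \<open>\<open>Fatou_power2\<close> takes a constant bound, while the values along the
    sequence lie below \<open>d\<close> plus a vanishing term. The slack \<open>e\<close> is removed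
    at the end by \<open>field_le_epsilon\<close>.\<close>
  have f\<mu>: "integrable unit_interval (\<lambda>u. (f u - quantile \<mu> u)\<^sup>2)
      \<and> (\<integral>u. (f u - quantile \<mu> u)\<^sup>2 \<partial>unit_interval) \<le> d + e" if "e > 0" for e
  proof -
    have "AE u in unit_interval. (\<lambda>i. quantile (\<nu> (r i)) u - quantile \<mu> u) \<longlonglongrightarrow> f u - quantile \<mu> u"
      using lim by eventually_elim (intro tendsto_intros)
    moreover have "\<forall>\<^sub>F i in sequentially. (\<integral>u. (quantile (\<nu> (r i)) u - quantile \<mu> u)\<^sup>2 \<partial>unit_interval) \<le> d + e"
      using order_tendstoD(2)[OF LIMSEQ_inverse_real_of_nat \<open>e > 0\<close>]
    proof eventually_elim
      case (elim i)
      have "1 / real (Suc (r i)) \<le> inverse (Suc i)"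
        using r_le[of i] by (simp add: field_simps)
      then show ?case
        using \<nu>J[of "r i"] elim by (simp add: J_def)
    qed
    ultimately show ?thesis
      using Fatou_power2[of "\<lambda>i u. quantile (\<nu> (r i)) u - quantile \<mu> u" unit_interval "\<lambda>u. f u - quantile \<mu> u" "d + e"] \<nu>P \<mu>
      by (simp add: P2_integrable_quantile_diff_square)
  qed
  have f_int: "integrable unit_interval (\<lambda>u. (f u)\<^sup>2)"
    using integrable_add_square[of "\<lambda>u. f u - quantile \<mu> u" unit_interval "quantile \<mu>"]
      P2_quantile_square_integrable[OF \<mu>] f\<mu>[of 1] by simp
  \<comment> \<open>Letting only the index along the subsequence tend to infinity in
    \<open>dist\<close> gives a rate for the whole sequence.\<close>
  have \<nu>f: "(\<integral>u. (f u - quantile (\<nu> n) u)\<^sup>2 \<partial>unit_interval) \<le> 4 / Suc n" for n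
  proof -
    have "AE u in unit_interval. (\<lambda>i. quantile (\<nu> (r i)) u - quantile (\<nu> n) u) \<longlonglongrightarrow> f u - quantile (\<nu> n) u"
      using lim by eventually_elim (intro tendsto_intros)
    moreover have "\<forall>\<^sub>F i in sequentially. (\<integral>u. (quantile (\<nu> (r i)) u - quantile (\<nu> n) u)\<^sup>2 \<partial>unit_interval) \<le> 4 / Suc n"
      using eventually_ge_at_top[of n]
    proof eventually_elim
      case (elim i)
      then show ?case
        using dist[of n "r i"] r_le[of i] by (simp add: power2_commute)
    qed
    ultimately show ?thesis
      using Fatou_power2[of "\<lambda>i u. quantile (\<nu> (r i)) u - quantile (\<nu> n) u" unit_interval "\<lambda>u. f u - quantile (\<nu> n) u" "4 / Suc n"] \<nu>P
      by (simp add: P2_integrable_quantile_diff_square)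
  qed
  \<comment> \<open>\<open>f\<close> is not shown to be a quantile function. Its law is the
    candidate, and \<open>W2_p_le\<close> compares it with other measures through the coupling that
    \<open>f\<close> itself provides.\<close>
  define p where "p = distr unit_interval borel f"
  have p: "p \<in> P2"
    unfolding p_def by (intro distr_P2 f_int) (auto intro: unit_interval.prob_space_axioms)
  have W2_p_le: "W2 p \<kappa> \<le> sqrt (\<integral>u. (f u - quantile \<kappa> u)\<^sup>2 \<partial>unit_interval)" if "\<kappa> \<in> P2" for \<kappa>
    using W2_le_random_variables[OF unit_interval.prob_space_axioms, of f "quantile \<kappa>"] that
      integrable_diff_square[of f unit_interval "quantile \<kappa>"] f_int P2_quantile_square_integrable[OF that]
    by (simp add: distr_quantile P2_real_distribution p_def)
  have "p \<in> F"
  proof (rule W2_closed_sequentially[OF closed \<nu>F p])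
    have le: "W2 p (\<nu> n) \<le> sqrt (4 * inverse (real (Suc n)))" for n
      using order_trans[OF W2_p_le[OF \<nu>P[of n]] real_sqrt_le_mono[OF \<nu>f[of n]]] by (simp add: divide_inverse)
    have "(\<lambda>n. sqrt (4 * inverse (real (Suc n)))) \<longlonglongrightarrow> sqrt (4 * 0)"
      by (intro tendsto_intros LIMSEQ_inverse_real_of_nat)
    then have "(\<lambda>n. sqrt (4 * inverse (real (Suc n)))) \<longlonglongrightarrow> 0"
      by simp
    then show "(\<lambda>n. W2 p (\<nu> n)) \<longlonglongrightarrow> 0"
      by (rule tendsto_sandwich[OF always_eventually always_eventually tendsto_const, rotated -1])
        (simp_all only: W2_nonneg le simp_thms)
  qed
  moreover have "W2 p \<mu> \<le> W2 \<kappa> \<mu>" if "\<kappa> \<in> F" for \<kappa>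
  proof -
    have "(\<integral>u. (f u - quantile \<mu> u)\<^sup>2 \<partial>unit_interval) \<le> d"
      by (rule field_le_epsilon) (use f\<mu> in blast)
    also have "\<dots> \<le> J \<kappa>"
      using d_le that by blast
    finally have "W2 p \<mu> \<le> sqrt (J \<kappa>)"
      by (intro order_trans[OF W2_p_le[OF \<mu>]] real_sqrt_le_mono)
    moreover have "W2 \<kappa> \<mu> = sqrt (J \<kappa>)"
      using that F \<mu> by (auto simp: J_def W2_eq_quantile P2_real_distribution)
    ultimately show ?thesis
      by simp
  qed
  ultimately have "is_arg_min (\<lambda>\<nu>. W2 \<nu> \<mu>) (\<lambda>\<nu>. \<nu> \<in> F) p"
    by (auto simp: is_arg_min_linorder)
  then show ?thesis by (rule that)
qed

text \<open>The first-order condition for a minimum over a convex set: moving from \<open>p\<close>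
  a fraction t towards \<nu> cannot decrease the distance to \<mu>. After division by t the
  quadratic remainder vanishes as t tends to 0. Geometrically, the angle at \<open>p\<close> is not
  acute.\<close>

lemma W2_minimizer_variational_inequality:
  assumes F: "F \<subseteq> P2" and conv: "displacement_convex F" and \<mu>: "\<mu> \<in> P2"
    and p: "is_arg_min (\<lambda>\<nu>. W2 \<nu> \<mu>) (\<lambda>\<nu>. \<nu> \<in> F) p" and \<nu>: "\<nu> \<in> F"
  shows "(\<integral>u. (quantile \<mu> u - quantile p u) * (quantile \<nu> u - quantile p u) \<partial>unit_interval) \<le> 0"
    (is "?B \<le> 0")
proof -
  let ?C = "\<integral>u. (quantile \<nu> u - quantile p u)\<^sup>2 \<partial>unit_interval"
  have pF: "p \<in> F" and p_min: "\<And>\<rho>. \<rho> \<in> F \<Longrightarrow> W2 p \<mu> \<le> W2 \<rho> \<mu>"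
    using p by (auto simp: is_arg_min_linorder)
  have *: "2 * ?B \<le> t * ?C" if t: "0 < t" "t \<le> 1" for t
  proof -
    obtain \<rho> where \<rho>: "\<rho> \<in> F" "\<And>u. u \<in> {0<..<1} \<Longrightarrow> quantile \<rho> u = (1 - t) * quantile p u + t * quantile \<nu> u"
      using displacement_convexD[OF conv pF \<nu>, of t] t by auto
    have P: "p \<in> P2" "\<nu> \<in> P2" "\<rho> \<in> P2"
      using F pF \<nu> \<rho> by auto
    have "(W2 \<rho> \<mu>)\<^sup>2 = (\<integral>u. (quantile p u - quantile \<mu> u)\<^sup>2
        - 2 * t * ((quantile \<mu> u - quantile p u) * (quantile \<nu> u - quantile p u))
        + t\<^sup>2 * (quantile \<nu> u - quantile p u)\<^sup>2 \<partial>unit_interval)"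
      unfolding W2_power2[OF P(3) \<mu>]
      by (intro Bochner_Integration.integral_cong) (simp_all add: \<rho>(2) power2_eq_square algebra_simps)
    also have "\<dots> = (W2 p \<mu>)\<^sup>2 - 2 * t * ?B + t\<^sup>2 * ?C"
      using P \<mu> by (simp add: W2_power2 P2_integrable_quantile_diff_square P2_integrable_quantile_diff_mult)
    finally have "2 * t * ?B \<le> t\<^sup>2 * ?C"
      using power_mono[OF p_min[OF \<rho>(1)] W2_nonneg, of 2] by simp
    then have "t * (2 * ?B) \<le> t * (t * ?C)"
      by (simp add: power2_eq_square mult_ac)
    then show ?thesis
      using t by simp
  qed
  have "((\<lambda>t. t * ?C) \<longlongrightarrow> 0 * ?C) (at_right 0)"
    by (intro tendsto_intros)
  moreover have "\<forall>\<^sub>F t in at_right 0. 2 * ?B \<le> t * ?C"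
    using * by (auto simp: eventually_at_right_field intro!: exI[of _ 1])
  ultimately have "2 * ?B \<le> 0 * ?C"
    by (intro tendsto_lowerbound) auto
  then show ?thesis by simp
qed

text \<open>Adding the variational inequalities at \<open>p\<close> and at \<open>q\<close> bounds
  the squared distance of the minimizers by the inner product of \<mu> - \<nu> and p - q, read as
  quantile functions; Cauchy-Schwarz finishes. Speaking of arbitrary minimizers instead of
  \<open>W2_proj\<close> makes the result available for the uniqueness proof.\<close>

lemma W2_minimizer_nonexpansive:
  assumes F: "F \<subseteq> P2" and conv: "displacement_convex F" and \<mu>: "\<mu> \<in> P2" and \<nu>: "\<nu> \<in> P2"
    and p: "is_arg_min (\<lambda>\<rho>. W2 \<rho> \<mu>) (\<lambda>\<rho>. \<rho> \<in> F) p" and q: "is_arg_min (\<lambda>\<rho>. W2 \<rho> \<nu>) (\<lambda>\<rho>. \<rho> \<in> F) q"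
  shows "W2 p q \<le> W2 \<mu> \<nu>"
proof -
  have pq: "p \<in> F" "q \<in> F" and P: "p \<in> P2" "q \<in> P2"
    using p q F by (auto simp: is_arg_min_linorder)
  let ?a = "\<lambda>u. quantile \<mu> u - quantile \<nu> u" and ?b = "\<lambda>u. quantile p u - quantile q u"
  note int = P2_integrable_quantile_diff_mult P2_integrable_quantile_diff_square
  have "(\<integral>u. (?b u)\<^sup>2 - ?a u * ?b u \<partial>unit_interval)
      = (\<integral>u. (quantile \<mu> u - quantile p u) * (quantile q u - quantile p u)
         + (quantile \<nu> u - quantile q u) * (quantile p u - quantile q u) \<partial>unit_interval)"
    by (intro Bochner_Integration.integral_cong) (simp_all add: power2_eq_square algebra_simps)
  also have "\<dots> \<le> 0"
    using W2_minimizer_variational_inequality[OF F conv \<mu> p pq(2)]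
      W2_minimizer_variational_inequality[OF F conv \<nu> q pq(1)] P \<mu> \<nu>
    by (simp add: int)
  finally have "(W2 p q)\<^sup>2 \<le> (\<integral>u. ?a u * ?b u \<partial>unit_interval)"
    using P \<mu> \<nu> by (simp add: int W2_power2)
  also have "\<dots> \<le> W2 \<mu> \<nu> * W2 p q"
    using Cauchy_Schwarz_integral[of ?a unit_interval ?b] P \<mu> \<nu>
    by (simp add: int W2_eq_quantile P2_real_distribution)
  \<comment> \<open>The factor \<open>W2 p q\<close> is cancelled, so its vanishing is a separate
    case.\<close>
  finally show ?thesis
    using W2_nonneg[of p q] W2_nonneg[of \<mu> \<nu>] by (cases "W2 p q = 0") (auto simp: power2_eq_square)
qed

text \<open>Uniqueness is nonexpansiveness applied to two minimizers for the same measure; with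
  existence it makes the definite description in \<open>W2_proj\<close> denote.\<close>

lemma W2_proj_is_arg_min:
  assumes "F \<noteq> {}" "F \<subseteq> P2" "displacement_convex F" "W2_closed F" "\<mu> \<in> P2"
  shows "is_arg_min (\<lambda>\<nu>. W2 \<nu> \<mu>) (\<lambda>\<nu>. \<nu> \<in> F) (W2_proj F \<mu>)"
proof -
  obtain p where p: "is_arg_min (\<lambda>\<nu>. W2 \<nu> \<mu>) (\<lambda>\<nu>. \<nu> \<in> F) p"
    using W2_minimizer_exists[OF assms] .
  have "q = p" if q: "is_arg_min (\<lambda>\<nu>. W2 \<nu> \<mu>) (\<lambda>\<nu>. \<nu> \<in> F) q" for q
  proof -
    have "q \<in> P2" "p \<in> P2"
      using p q assms(2) by (auto simp: is_arg_min_linorder)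
    moreover have "W2 q p \<le> 0"
      using W2_minimizer_nonexpansive[OF assms(2,3,5,5) q p] W2_eq_0_iff[OF assms(5,5)] by simp
    ultimately show ?thesis
      using W2_nonneg[of q p] by (simp flip: W2_eq_0_iff)
  qed
  with p show ?thesis
    unfolding W2_proj_def by (rule theI)
qed

lemma W2_proj_nonexpansive:
  assumes "F \<noteq> {}" "F \<subseteq> P2" "displacement_convex F" "W2_closed F" "\<mu> \<in> P2" "\<nu> \<in> P2"
  shows "W2 (W2_proj F \<mu>) (W2_proj F \<nu>) \<le> W2 \<mu> \<nu>"
  by (rule W2_minimizer_nonexpansive[OF assms(2,3,5,6) W2_proj_is_arg_min[OF assms(1-5)]
        W2_proj_is_arg_min[OF assms(1-4,6)]])

subsection \<open>Averages of i.i.d. random variables\<close>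

text \<open>For the centred variables independence makes the mixed products have mean zero, so only
  the diagonal of the double sum survives.\<close>

lemma (in prob_space) variance_sum_indep_vars:
  fixes X :: "'i \<Rightarrow> 'a \<Rightarrow> real"
  assumes "finite I" and indep: "indep_vars (\<lambda>_. borel) X I"
    and sq: "\<And>i. i \<in> I \<Longrightarrow> integrable M (\<lambda>\<omega>. (X i \<omega>)\<^sup>2)"
  shows "variance (\<lambda>\<omega>. \<Sum>i\<in>I. X i \<omega>) = (\<Sum>i\<in>I. variance (X i))"
proof -
  have rv [measurable]: "random_variable borel (X i)" if "i \<in> I" for i
    using indep that by (auto simp: indep_vars_def)
  have int: "integrable M (X i)" if "i \<in> I" for i
    using square_integrable_imp_integrable[of "X i"] sq rv that by blast
  define Y where "Y i \<omega> = X i \<omega> - expectation (X i)" for i \<omega>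
  have Y_int: "integrable M (Y i)" and Y_0: "expectation (Y i) = 0" if "i \<in> I" for i
    unfolding Y_def using int[OF that] by (auto simp: prob_space)
  have Y_indep: "indep_vars (\<lambda>_. borel) Y I"
    unfolding Y_def by (rule indep_vars_compose2[OF indep]) auto
  have cross: "integrable M (\<lambda>\<omega>. Y i \<omega> * Y j \<omega>) \<and> expectation (\<lambda>\<omega>. Y i \<omega> * Y j \<omega>) = (if i = j then variance (X i) else 0)"
    if ij: "i \<in> I" "j \<in> I" for i j
  proof (cases "i = j")
    case True
    then show ?thesis
      using sq[OF ij(1)] int[OF ij(1)] by (simp add: Y_def power2_diff flip: power2_eq_square)
  next
    case False
    have ind: "indep_vars (\<lambda>_. borel) Y {i, j}"
      by (rule indep_vars_subset[OF Y_indep]) (use ij in auto)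
    show ?thesis
      using indep_vars_lebesgue_integral[OF _ ind] indep_vars_integrable[OF _ ind] False ij Y_int Y_0 by auto
  qed
  have "expectation (\<lambda>\<omega>. \<Sum>i\<in>I. X i \<omega>) = (\<Sum>i\<in>I. expectation (X i))"
    using int by simp
  then have "variance (\<lambda>\<omega>. \<Sum>i\<in>I. X i \<omega>) = expectation (\<lambda>\<omega>. \<Sum>i\<in>I. \<Sum>j\<in>I. Y i \<omega> * Y j \<omega>)"
    by (simp add: Y_def power2_eq_square flip: sum_subtractf sum_product)
  also have "\<dots> = (\<Sum>i\<in>I. \<Sum>j\<in>I. expectation (\<lambda>\<omega>. Y i \<omega> * Y j \<omega>))"
    using cross by (simp add: Bochner_Integration.integral_sum Bochner_Integration.integrable_sum)
  also have "\<dots> = (\<Sum>i\<in>I. variance (X i))"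
    using cross \<open>finite I\<close> by (simp add: sum.delta)
  finally show ?thesis .
qed

text \<open>The nonzero terms form a geometric series with ratio 1/2. It starts at the first 2^k >=
  z, where the term is at most z. Integrated, the estimate makes the Chebyshev bounds for the
  truncated sums summable.\<close>

lemma dyadic_sum_truncated_square_le:
  fixes z :: real
  assumes "0 \<le> z"
  shows "(\<Sum>k<n. (if z \<le> 2 ^ k then z else 0)\<^sup>2 / 2 ^ k) \<le> 2 * z"
proof -
  let ?S = "\<lambda>n. \<Sum>k<n. (if z \<le> 2 ^ k then z else 0)\<^sup>2 / 2 ^ k"
  \<comment> \<open>The subtracted 2 z^2 / 2^n is the tail of the series from index n on; carrying
    it along makes the induction close.\<close>
  have "(z \<le> 2 ^ n \<longrightarrow> ?S n \<le> 2 * z - 2 * z\<^sup>2 / 2 ^ n) \<and> (z > 2 ^ n \<longrightarrow> ?S n = 0)"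
  proof (induction n)
    case 0
    have "z \<le> 1 \<Longrightarrow> z * z \<le> z * 1"
      using assms by (intro mult_left_mono) auto
    then show ?case by (simp add: power2_eq_square)
  next
    case (Suc n)
    show ?case
    proof (cases "z \<le> 2 ^ n")
      case True
      then have "\<not> z > 2 ^ Suc n"
        using power_increasing[of n "Suc n" "2::real"] by linarith
      moreover have "2 * z\<^sup>2 / 2 ^ Suc n = z\<^sup>2 / 2 ^ n"
        by simp
      ultimately show ?thesis
        using Suc True by (simp del: power_Suc)
    next
      case False
      have "z * z \<le> z * 2 ^ Suc n" if "z \<le> 2 ^ Suc n"
        using assms that by (intro mult_left_mono) auto
      then have "2 * z\<^sup>2 / 2 ^ Suc n \<le> 2 * z" if "z \<le> 2 ^ Suc n"
        using that by (simp add: power2_eq_square field_simps)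
      then show ?thesis
        using Suc False by simp
    qed
  qed
  moreover have "2 * z\<^sup>2 / 2 ^ n \<ge> 0"
    by simp
  ultimately show ?thesis
    using assms by (cases "z \<le> 2 ^ n") (auto intro: order_trans)
qed

text \<open>A sum of distinct powers of 2 is less than twice the largest of them, and that one lies
  below z. Integrated, the estimate makes the probabilities that truncation changes a summand
  summable.\<close>

lemma dyadic_sum_tail_le:
  fixes z :: real
  assumes "0 \<le> z"
  shows "(\<Sum>k<n. 2 ^ k * of_bool (2 ^ k < z)) \<le> 2 * z"
proof -
  \<comment> \<open>The first conjunct strengthens the induction: if 2^n < z, the earlier terms add
    at most 2^n, so the new total stays below 2 z.\<close>
  have "(\<Sum>k<n. 2 ^ k * of_bool (2 ^ k < z)) \<le> (2 ^ n :: real) \<and> (\<Sum>k<n. 2 ^ k * of_bool (2 ^ k < z)) \<le> 2 * z"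
  proof (induction n)
    case (Suc n)
    then show ?case
      by (cases "2 ^ n < z") (simp_all del: sum_mult_of_bool_eq sum_of_bool_mult_eq)
  qed (use assms in simp)
  then show ?thesis by simp
qed

section \<open>Almost sure bounds and limits for averages\<close>

locale iid_random_variables = prob_space +
  fixes X :: "nat \<Rightarrow> 'a \<Rightarrow> real" and \<mu> :: "real measure"
  assumes indep: "indep_vars (\<lambda>_. borel) X {1..}"
    and distr: "\<And>i. i \<ge> 1 \<Longrightarrow> distr M borel (X i) = \<mu>"
begin

lemma random_variable [measurable]: "i \<ge> 1 \<Longrightarrow> random_variable borel (X i)"
  using indep by (auto simp: indep_vars_def)

lemma integral_X:
  fixes g :: "real \<Rightarrow> real"
  assumes "i \<ge> 1" "g \<in> borel_measurable borel"
  shows "expectation (\<lambda>\<omega>. g (X i \<omega>)) = (\<integral>x. g x \<partial>\<mu>)"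
  using assms by (simp add: integral_distr flip: distr[OF assms(1)])

lemma integrable_X_iff:
  fixes g :: "real \<Rightarrow> real"
  assumes "i \<ge> 1" "g \<in> borel_measurable borel"
  shows "integrable M (\<lambda>\<omega>. g (X i \<omega>)) \<longleftrightarrow> integrable \<mu> g"
  using assms by (simp add: integrable_distr_eq flip: distr[OF assms(1)])

text \<open>Makes the bound on averages of nonnegative variables applicable to the squared tails of
  the samples.\<close>

lemma compose:
  assumes [measurable]: "g \<in> borel_measurable borel"
  shows "iid_random_variables M (\<lambda>i \<omega>. g (X i \<omega>)) (distr \<mu> borel g)"
proof
  show "indep_vars (\<lambda>_. borel) (\<lambda>i \<omega>. g (X i \<omega>)) {1..}"
    by (rule indep_vars_compose2[OF indep]) auto
  fix i :: nat assume "i \<ge> 1"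
  then show "distr M borel (\<lambda>\<omega>. g (X i \<omega>)) = distr \<mu> borel g"
    by (simp add: distr_distr comp_def flip: distr[of i])
qed

text \<open>Only a first moment is assumed, so the first 2^k variables are all truncated at the
  common level 2^k. The variance of the truncated sum and the probability that truncation changes a
  summand are controlled by the two dyadic estimates. Since only an upper bound is sought, it is
  harmless that truncation lowers the mean.\<close>

lemma dyadic_sums_bounded_AE:
  assumes nonneg: "\<And>i \<omega>. 0 \<le> X i \<omega>" and int: "integrable \<mu> (\<lambda>x. x)" and "0 < \<epsilon>"
  shows "AE \<omega> in M. \<forall>\<^sub>F k in sequentially. (\<Sum>i=1..2^k. X i \<omega>) < 2 ^ k * ((\<integral>x. x \<partial>\<mu>) + \<epsilon>)"
proof -
  let ?m = "\<integral>x. x \<partial>\<mu>"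
  define h where "h k z = (if z \<le> 2 ^ k then z else 0)" for k and z :: real
  have [measurable]: "h k \<in> borel_measurable borel" for k
    unfolding h_def by measurable
  have X1 [measurable]: "random_variable borel (X 1)" by simp
  have hX_bound: "0 \<le> h k (X i \<omega>)" "h k (X i \<omega>) \<le> X i \<omega>" "h k (X i \<omega>) \<le> 2 ^ k" for k i \<omega>
    using nonneg[of i \<omega>] by (auto simp: h_def)
  have X_int: "integrable M (X i)" "expectation (X i) = ?m" if "i \<ge> 1" for i
    using integrable_X_iff[OF that measurable_ident_sets[OF refl]] integral_X[OF that measurable_ident_sets[OF refl]] int
    by blast+
  have hX_meas: "random_variable borel (\<lambda>\<omega>. h k (X i \<omega>))" if "i \<ge> 1" for k i
    by (rule measurable_compose[OF random_variable[OF that]]) simp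
  have h_int: "integrable M (\<lambda>\<omega>. h k (X i \<omega>))" if "i \<ge> 1" for k i
    using hX_bound hX_meas[OF that] by (intro integrable_const_bound[where B = "2 ^ k"] AE_I2) simp_all
  have h2_int: "integrable M (\<lambda>\<omega>. (h k (X i \<omega>))\<^sup>2)" if "i \<ge> 1" for k i
    using hX_bound hX_meas[OF that]
    by (intro integrable_const_bound[where B = "(2 ^ k)\<^sup>2"] AE_I2)
      (simp_all only: real_norm_def abs_power2 power_mono borel_measurable_power)
  define V where "V k = expectation (\<lambda>\<omega>. (h k (X 1 \<omega>))\<^sup>2)" for k
  define T where "T k \<omega> = (\<Sum>i=1..2^k. h k (X i \<omega>))" for k \<omega>
  have [measurable]: "random_variable borel (T k)" for k
    unfolding T_def by (rule borel_measurable_sum) (simp add: hX_meas)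
  have T2_int: "integrable M (\<lambda>\<omega>. (T k \<omega>)\<^sup>2)" for k
  proof (rule integrable_const_bound[where B = "(2 ^ k * 2 ^ k)\<^sup>2"])
    have "T k \<omega> \<le> 2 ^ k * 2 ^ k" "0 \<le> T k \<omega>" for \<omega>
      using sum_bounded_above[of "{1..2^k}" "\<lambda>i. h k (X i \<omega>)" "2 ^ k"] hX_bound
      by (auto simp: T_def intro: sum_nonneg)
    then show "AE \<omega> in M. norm ((T k \<omega>)\<^sup>2) \<le> (2 ^ k * 2 ^ k)\<^sup>2"
      by (intro AE_I2) (simp only: real_norm_def abs_power2 power_mono)
  qed simp
  have ET: "expectation (T k) \<le> 2 ^ k * ?m" for k
  proof -
    have "expectation (T k) = (\<Sum>i=1..2^k. expectation (\<lambda>\<omega>. h k (X i \<omega>)))"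
      unfolding T_def using h_int by (intro Bochner_Integration.integral_sum) auto
    also have "\<dots> \<le> (\<Sum>i=1..(2::nat)^k. ?m)"
    proof (rule sum_mono)
      fix i :: nat assume "i \<in> {1..2^k}"
      then have i: "i \<ge> 1" by simp
      show "expectation (\<lambda>\<omega>. h k (X i \<omega>)) \<le> ?m"
        unfolding X_int(2)[OF i, symmetric] by (intro integral_mono h_int X_int i hX_bound)
    qed
    finally show ?thesis by simp
  qed
  have VT: "variance (T k) \<le> 2 ^ k * V k" for k
  proof -
    have "variance (T k) = (\<Sum>i=1..2^k. variance (\<lambda>\<omega>. h k (X i \<omega>)))"
      unfolding T_def
    proof (rule variance_sum_indep_vars)
      show "indep_vars (\<lambda>_. borel) (\<lambda>i \<omega>. h k (X i \<omega>)) {1..2^k}"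
        by (rule indep_vars_compose2[OF indep_vars_subset[OF indep]]) auto
    qed (auto intro: h2_int)
    also have "\<dots> \<le> (\<Sum>i=1..(2::nat)^k. V k)"
    proof (rule sum_mono)
      fix i :: nat assume "i \<in> {1..2^k}"
      then have i: "i \<ge> 1" by simp
      have "variance (\<lambda>\<omega>. h k (X i \<omega>)) \<le> expectation (\<lambda>\<omega>. (h k (X i \<omega>))\<^sup>2)"
        using h_int[OF i] h2_int[OF i] by (subst variance_eq) auto
      also have "\<dots> = V k"
        unfolding V_def using integral_X[OF i, of "\<lambda>x. (h k x)\<^sup>2"] integral_X[of 1 "\<lambda>x. (h k x)\<^sup>2"] by simp
      finally show "variance (\<lambda>\<omega>. h k (X i \<omega>)) \<le> V k" .
    qed
    finally show ?thesis by simp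
  qed
  define A where "A k = {\<omega>\<in>space M. 2 ^ k * (?m + \<epsilon>) \<le> (\<Sum>i=1..2^k. X i \<omega>)}" for k :: nat
  have S_meas: "random_variable borel (\<lambda>\<omega>. \<Sum>i=1..n. X i \<omega>)" for n
    by (rule borel_measurable_sum) auto
  have A_meas [measurable]: "A k \<in> events" for k
    unfolding A_def using S_meas by (intro borel_measurable_le) auto
  have A_le: "prob (A k) \<le> (V k / 2 ^ k) / \<epsilon>\<^sup>2 + 2 ^ k * prob {\<omega>\<in>space M. 2 ^ k < X 1 \<omega>}" for k
  proof -
    have le_meas: "{\<omega>\<in>space M. 2 ^ k < X i \<omega>} \<in> events" if "i \<ge> 1" for i
      using random_variable[OF that] by simp
    \<comment> \<open>If no variable exceeds 2^k, the truncated sum is the full sum. Its mean is at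
      most \<open>2 ^ k * ?m\<close>, so reaching the threshold forces a deviation of at least
      \<open>2 ^ k * \<epsilon>\<close>.\<close>
    have "A k \<subseteq> {\<omega>\<in>space M. 2 ^ k * \<epsilon> \<le> \<bar>T k \<omega> - expectation (T k)\<bar>} \<union> (\<Union>i\<in>{1..2^k}. {\<omega>\<in>space M. 2 ^ k < X i \<omega>})"
    proof (rule subsetI, rule UnCI)
      fix \<omega> assume \<omega>: "\<omega> \<in> A k" and "\<omega> \<notin> (\<Union>i\<in>{1..2^k}. {\<omega>\<in>space M. 2 ^ k < X i \<omega>})"
      then have "T k \<omega> = (\<Sum>i=1..2^k. X i \<omega>)"
        by (auto simp: T_def h_def A_def not_less intro!: sum.cong)
      then show "\<omega> \<in> {\<omega>\<in>space M. 2 ^ k * \<epsilon> \<le> \<bar>T k \<omega> - expectation (T k)\<bar>}"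
        using \<omega> ET[of k] by (auto simp: A_def algebra_simps)
    qed
    then have "prob (A k) \<le> prob ({\<omega>\<in>space M. 2 ^ k * \<epsilon> \<le> \<bar>T k \<omega> - expectation (T k)\<bar>} \<union> (\<Union>i\<in>{1..2^k}. {\<omega>\<in>space M. 2 ^ k < X i \<omega>}))"
      using le_meas by (intro finite_measure_mono) (auto intro!: sets.Un sets.finite_UN)
    also have "\<dots> \<le> prob {\<omega>\<in>space M. 2 ^ k * \<epsilon> \<le> \<bar>T k \<omega> - expectation (T k)\<bar>} + prob (\<Union>i\<in>{1..2^k}. {\<omega>\<in>space M. 2 ^ k < X i \<omega>})"
      using le_meas by (intro measure_Un_le) (auto intro!: sets.finite_UN)
    also have "prob (\<Union>i\<in>{1..2^k}. {\<omega>\<in>space M. 2 ^ k < X i \<omega>}) \<le> (\<Sum>i=1..2^k. prob {\<omega>\<in>space M. 2 ^ k < X i \<omega>})"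
      using le_meas by (intro measure_UNION_le) auto
    also have "\<dots> = (\<Sum>i=1..(2::nat)^k. prob {\<omega>\<in>space M. 2 ^ k < X 1 \<omega>})"
    proof (rule sum.cong)
      fix i :: nat assume "i \<in> {1..2^k}"
      then have i: "i \<ge> 1" by simp
      have "prob {\<omega>\<in>space M. 2 ^ k < X i \<omega>} = measure \<mu> {2 ^ k<..}" if "i \<ge> 1" for i
        using random_variable[OF that] by (simp add: measure_distr vimage_def Int_def conj_commute flip: distr[OF that])
      from this[OF i] this[of 1] show "prob {\<omega>\<in>space M. 2 ^ k < X i \<omega>} = prob {\<omega>\<in>space M. 2 ^ k < X 1 \<omega>}"
        by simp
    qed simp
    also have "prob {\<omega>\<in>space M. 2 ^ k * \<epsilon> \<le> \<bar>T k \<omega> - expectation (T k)\<bar>} \<le> variance (T k) / (2 ^ k * \<epsilon>)\<^sup>2"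
      using T2_int \<open>0 < \<epsilon>\<close> by (intro Chebyshev_inequality) auto
    also have "\<dots> \<le> 2 ^ k * V k / (2 ^ k * \<epsilon>)\<^sup>2"
      using VT by (intro divide_right_mono) auto
    also have "\<dots> = (V k / 2 ^ k) / \<epsilon>\<^sup>2"
      using \<open>0 < \<epsilon>\<close> by (simp add: power2_eq_square field_simps)
    finally show ?thesis by simp
  qed
  have h_sum: "(\<Sum>k<n. (h k z)\<^sup>2 / 2 ^ k) \<le> 2 * z" if "0 \<le> z" for n z
    unfolding h_def using that by (rule dyadic_sum_truncated_square_le)
  have X1_int: "integrable M (X 1)" "expectation (X 1) = ?m" using X_int by auto
  have sum1: "summable (\<lambda>k. V k / 2 ^ k)"
  proof (rule summableI_nonneg_bounded)
    fix n
    have "(\<Sum>k<n. V k / 2 ^ k) = expectation (\<lambda>\<omega>. \<Sum>k<n. (h k (X 1 \<omega>))\<^sup>2 / 2 ^ k)"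
      unfolding V_def using h2_int[of 1] by simp
    also have "\<dots> \<le> expectation (\<lambda>\<omega>. 2 * X 1 \<omega>)"
      using h2_int[of 1] X1_int h_sum[OF nonneg] by (intro integral_mono) simp_all
    finally show "(\<Sum>k<n. V k / 2 ^ k) \<le> 2 * ?m"
      using X1_int by simp
  qed (simp add: V_def)
  have sum2: "summable (\<lambda>k. 2 ^ k * prob {\<omega>\<in>space M. 2 ^ k < X 1 \<omega>})"
  proof (rule summableI_nonneg_bounded)
    fix n
    \<comment> \<open>\<open>of_bool\<close> brings the probability into the form in which
      \<open>dyadic_sum_tail_le\<close> applies pointwise.\<close>
    have p: "prob {\<omega>\<in>space M. 2 ^ k < X 1 \<omega>} = expectation (\<lambda>\<omega>. of_bool (2 ^ k < X 1 \<omega>))" for k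
    proof -
      have "prob {\<omega>\<in>space M. 2 ^ k < X 1 \<omega>} = expectation (indicator {\<omega>\<in>space M. 2 ^ k < X 1 \<omega>})"
        by simp
      also have "\<dots> = expectation (\<lambda>\<omega>. of_bool (2 ^ k < X 1 \<omega>))"
        by (intro Bochner_Integration.integral_cong) (auto simp: indicator_def)
      finally show ?thesis .
    qed
    have b_int: "integrable M (\<lambda>\<omega>. of_bool (2 ^ k < X 1 \<omega>) :: real)" for k
      by (intro integrable_const_bound[where B = 1]) auto
    have "(\<Sum>k<n. 2 ^ k * prob {\<omega>\<in>space M. 2 ^ k < X 1 \<omega>}) = expectation (\<lambda>\<omega>. \<Sum>k<n. 2 ^ k * of_bool (2 ^ k < X 1 \<omega>))"
      unfolding p using b_int by (simp del: sum_mult_of_bool_eq sum_of_bool_mult_eq)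
    also have "\<dots> \<le> expectation (\<lambda>\<omega>. 2 * X 1 \<omega>)"
      using b_int X1_int dyadic_sum_tail_le[OF nonneg]
      by (intro integral_mono) (simp_all del: sum_mult_of_bool_eq sum_of_bool_mult_eq)
    finally show "(\<Sum>k<n. 2 ^ k * prob {\<omega>\<in>space M. 2 ^ k < X 1 \<omega>}) \<le> 2 * ?m"
      using X1_int by simp
  qed simp
  have "summable (\<lambda>k. prob (A k))"
    using summable_add[OF summable_divide[OF sum1, of "\<epsilon>\<^sup>2"] sum2]
    by (rule summable_comparison_test'[where N = 0]) (simp only: real_norm_def abs_of_nonneg[OF measure_nonneg] A_le)
  then have "AE \<omega> in M. \<forall>\<^sub>F k in sequentially. \<omega> \<in> space M - A k"
    by (intro borel_cantelli_AE1) (auto simp: less_top[symmetric])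
  then show ?thesis
    by eventually_elim (auto elim!: eventually_mono simp: A_def)
qed

text \<open>For 2^k <= n < 2^(k+1), nonnegativity bounds the sum up to n by the sum up to 2^(k+1),
  and 2^(k+1) <= 2 n. This is the origin of the factor 2.\<close>

lemma averages_bounded_AE:
  assumes nonneg: "\<And>i \<omega>. 0 \<le> X i \<omega>" and int: "integrable \<mu> (\<lambda>x. x)" and "0 < \<epsilon>"
  shows "AE \<omega> in M. \<forall>\<^sub>F n in sequentially. (\<Sum>i=1..n. X i \<omega>) / n \<le> 2 * ((\<integral>x. x \<partial>\<mu>) + \<epsilon>)"
  using dyadic_sums_bounded_AE[OF assms]
proof eventually_elim
  case (elim \<omega>)
  let ?m = "\<integral>x. x \<partial>\<mu>"
  obtain K where K: "\<And>k. k \<ge> K \<Longrightarrow> (\<Sum>i=1..2^k. X i \<omega>) < 2 ^ k * (?m + \<epsilon>)"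
    using elim by (auto simp: eventually_sequentially)
  have "(\<Sum>i=1..n. X i \<omega>) / n \<le> 2 * (?m + \<epsilon>)" if n: "2 ^ K \<le> n" for n :: nat
  proof -
    have "n \<ge> 1"
      using n one_le_power[of "2::nat" K] by linarith
    then obtain k where k: "2 ^ k \<le> n" "n < 2 ^ (k + 1)"
      using ex_power_ivl1[of 2 n] by auto
    have "(2::nat) ^ K < 2 ^ (k + 1)"
      using n k by linarith
    then have "K < k + 1"
      by (rule power_less_imp_less_exp[rotated]) simp
    then have "(\<Sum>i=1..2^(k+1). X i \<omega>) < 2 ^ (k + 1) * (?m + \<epsilon>)"
      by (intro K) simp
    moreover have "(\<Sum>i=1..n. X i \<omega>) \<le> (\<Sum>i=1..2^(k+1). X i \<omega>)"
      using k nonneg by (intro sum_mono2) auto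
    moreover have "0 \<le> (\<Sum>i=1..n. X i \<omega>)"
      using nonneg by (intro sum_nonneg) auto
    ultimately have le: "(\<Sum>i=1..n. X i \<omega>) \<le> 2 ^ (k + 1) * (?m + \<epsilon>)" and "0 < 2 ^ (k + 1) * (?m + \<epsilon>)"
      by linarith+
    \<comment> \<open>The sign is read off from the strict upper bound on a nonnegative sum; it
      permits multiplying the estimate 2^(k+1) <= 2 n by this factor.\<close>
    then have "0 < ?m + \<epsilon>"
      by (simp add: zero_less_mult_iff)
    have "real (2 ^ k) \<le> real n"
      using k(1) by (rule of_nat_mono)
    then have "2 ^ (k + 1) * (?m + \<epsilon>) \<le> (2 * real n) * (?m + \<epsilon>)"
      using \<open>0 < ?m + \<epsilon>\<close> by (intro mult_right_mono) auto
    with le show ?thesis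
      using \<open>n \<ge> 1\<close> by (simp add: field_simps)
  qed
  then show ?case
    by (auto simp: eventually_sequentially)
qed

text \<open>Indicators take values in [0,1], so Hoeffding's inequality makes the deviation
  probabilities decay geometrically. The Borel-Cantelli lemma then applies along all n, without
  dyadic times.\<close>

lemma averages_indicator_tendsto_AE:
  assumes [measurable]: "B \<in> sets borel"
  shows "AE \<omega> in M. (\<lambda>n. (\<Sum>i=1..n. indicator B (X i \<omega>)) / n) \<longlonglongrightarrow> measure \<mu> B"
proof -
  have mean: "expectation (\<lambda>\<omega>. indicator B (X 1 \<omega>)) = measure \<mu> B"
    using integral_X[of 1 "indicator B"] sets_eq_imp_space_eq[of \<mu> borel] distr[of 1] by auto
  have S_meas: "random_variable borel (\<lambda>\<omega>. (\<Sum>i=1..n. indicator B (X i \<omega>) :: real))" for n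
    by (rule borel_measurable_sum) auto
  have dev: "AE \<omega> in M. \<forall>\<^sub>F n in sequentially. \<bar>(\<Sum>i=1..n. indicator B (X i \<omega>)) / n - measure \<mu> B\<bar> < \<epsilon>"
    if "0 < \<epsilon>" for \<epsilon> :: real
  proof -
    \<comment> \<open>The shift to \<open>Suc n\<close> keeps the denominator positive;
      \<open>eventually_sequentially_Suc\<close> undoes it.\<close>
    define A where "A n = {\<omega>\<in>space M. \<bar>(\<Sum>i=1..Suc n. indicator B (X i \<omega>)) / Suc n - measure \<mu> B\<bar> \<ge> \<epsilon>}" for n
    have A_meas: "A n \<in> events" for n
      unfolding A_def using S_meas[of "Suc n"] by measurable
    have A_le: "prob (A n) \<le> 2 * exp (-2 * \<epsilon>\<^sup>2) ^ Suc n" for n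
    proof -
      interpret H: Hoeffding_ineq_iid M "{1..Suc n}" "\<lambda>i \<omega>. indicator B (X i \<omega>)" "\<lambda>\<omega>. indicator B (X 1 \<omega>)" 0 1 "measure \<mu> B"
      proof unfold_locales
        show "measure \<mu> B \<equiv> expectation (\<lambda>\<omega>. indicator B (X 1 \<omega>))"
          by (simp only: mean)
        show "indep_vars (\<lambda>_. borel) (\<lambda>i \<omega>. indicator B (X i \<omega>) :: real) {1..Suc n}"
          by (rule indep_vars_compose2[OF indep_vars_subset[OF indep]]) auto
        fix i assume "i \<in> {1..Suc n}"
        then have i: "i \<ge> 1" by simp
        have "distr M borel (\<lambda>\<omega>. indicator B (X i \<omega>) :: real) = distr \<mu> borel (indicator B)" if "i \<ge> 1" for i
          using random_variable[OF that] by (simp add: distr_distr comp_def flip: distr[OF that])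
        from this[OF i] this[of 1]
        show "distr M borel (\<lambda>\<omega>. indicator B (X i \<omega>) :: real) = distr M borel (\<lambda>\<omega>. indicator B (X 1 \<omega>))"
          by simp
      qed (auto simp: indicator_def)
      have "prob (A n) \<le> 2 * exp (-2 * real (Suc n) * \<epsilon>\<^sup>2 / (1 - 0)\<^sup>2)"
        using H.Hoeffding_ineq_abs_ge'[of \<epsilon>] \<open>0 < \<epsilon>\<close> by (simp add: A_def)
      also have "exp (-2 * real (Suc n) * \<epsilon>\<^sup>2 / (1 - 0)\<^sup>2) = exp (-2 * \<epsilon>\<^sup>2) ^ Suc n"
        unfolding exp_of_nat_mult[symmetric] by (simp add: algebra_simps)
      finally show ?thesis .
    qed
    have "summable (\<lambda>n. 2 * exp (-2 * \<epsilon>\<^sup>2) ^ Suc n)"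
      using \<open>0 < \<epsilon>\<close> by (intro summable_mult summable_ignore_initial_segment[of _ 1, simplified] summable_geometric) auto
    then have "summable (\<lambda>n. prob (A n))"
      by (rule summable_comparison_test'[where N = 0]) (use A_le in auto)
    then have "AE \<omega> in M. \<forall>\<^sub>F n in sequentially. \<omega> \<in> space M - A n"
      using A_meas by (intro borel_cantelli_AE1) (auto simp: less_top[symmetric])
    then show ?thesis
    proof eventually_elim
      case (elim \<omega>)
      then have "\<forall>\<^sub>F n in sequentially. \<bar>(\<Sum>i=1..Suc n. indicator B (X i \<omega>)) / Suc n - measure \<mu> B\<bar> < \<epsilon>"
        by eventually_elim (auto simp: A_def)
      then show ?case
        by (rule eventually_sequentially_Suc[THEN iffD1])
    qed
  qed
  \<comment> \<open>Countably many tolerances suffice for convergence, so one null set serves for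
    all of them.\<close>
  have "AE \<omega> in M. \<forall>j. \<forall>\<^sub>F n in sequentially. \<bar>(\<Sum>i=1..n. indicator B (X i \<omega>)) / n - measure \<mu> B\<bar> < inverse (real (Suc j))"
    unfolding AE_all_countable using dev by simp
  then show ?thesis
  proof eventually_elim
    case (elim \<omega>)
    show ?case
      unfolding tendsto_iff dist_real_def
    proof (intro allI impI)
      fix e :: real assume "0 < e"
      then obtain j where "inverse (real (Suc j)) < e"
        using reals_Archimedean by blast
      then show "\<forall>\<^sub>F n in sequentially. \<bar>(\<Sum>i=1..n. indicator B (X i \<omega>)) / n - measure \<mu> B\<bar> < e"
        using elim[rule_format, of j] by (auto elim: eventually_mono)
    qed
  qed
qed

end

subsection \<open>Convergence of empirical measures\<close>

text \<open>Reading the measure as the law of a uniformly chosen sample turns integrals against it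
  into finite averages and makes \<open>distr_P2\<close> applicable.\<close>

lemma empirical_measure_eq_distr:
  assumes "n \<ge> 1"
  shows "empirical_measure n x = distr (measure_pmf (pmf_of_set {1..n})) borel x"
proof (rule measure_eqI)
  show "sets (empirical_measure n x) = sets (distr (measure_pmf (pmf_of_set {1..n})) borel x)"
    using sets.sigma_sets_eq[of "borel :: real measure"] by (simp add: empirical_measure_def)
next
  fix A assume "A \<in> sets (empirical_measure n x)"
  then have A: "A \<in> sets borel"
    using sets.sigma_sets_eq[of "borel :: real measure"] by (simp add: empirical_measure_def)
  have ind: "(\<Sum>i=1..n. indicator A (x i)) = ennreal (\<Sum>i=1..n. indicator A (x i))"
    by (subst sum_ennreal[symmetric]) (auto simp: ennreal_indicator)
  have "emeasure (distr (measure_pmf (pmf_of_set {1..n})) borel x) A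
      = (\<integral>\<^sup>+i. indicator (x -` A) i \<partial>measure_pmf (pmf_of_set {1..n}))"
    by (subst nn_integral_indicator) (use A in \<open>simp_all add: emeasure_distr\<close>)
  also have "\<dots> = (\<integral>\<^sup>+i. indicator A (x i) \<partial>measure_pmf (pmf_of_set {1..n}))"
    by (simp add: indicator_def)
  also have "\<dots> = (\<Sum>i=1..n. indicator A (x i)) / of_nat n"
    using assms by (subst nn_integral_pmf_of_set) auto
  also have "\<dots> = ennreal ((\<Sum>i=1..n. indicator A (x i)) / n)"
    unfolding ind ennreal_of_nat_eq_real_of_nat using assms by (intro divide_ennreal) (auto intro: sum_nonneg)
  also have "\<dots> = (\<Sum>i=1..n. ennreal (1 / real n) * indicator A (x i))"
    unfolding sum_distrib_left[symmetric] ind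
    by (subst ennreal_mult'[symmetric]) (auto intro: sum_nonneg)
  finally show "emeasure (empirical_measure n x) A = emeasure (distr (measure_pmf (pmf_of_set {1..n})) borel x) A"
    using A by (simp add: emeasure_empirical_measure)
qed

lemma integral_empirical_measure:
  fixes f :: "real \<Rightarrow> real"
  assumes "n \<ge> 1" and "f \<in> borel_measurable borel"
  shows "(\<integral>t. f t \<partial>empirical_measure n x) = (\<Sum>i=1..n. f (x i)) / n"
  using assms by (simp add: empirical_measure_eq_distr integral_distr integral_pmf_of_set)

lemma empirical_measure_P2:
  assumes "n \<ge> 1"
  shows "empirical_measure n x \<in> P2"
  unfolding empirical_measure_eq_distr[OF assms]
proof (rule distr_P2)
  show "integrable (measure_pmf (pmf_of_set {1..n})) (\<lambda>i. (x i)\<^sup>2)"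
    using assms by (intro integrable_measure_pmf_finite) auto
qed (auto intro: prob_space_measure_pmf)

lemma cdf_empirical_measure:
  assumes "n \<ge> 1"
  shows "cdf (empirical_measure n x) t = (\<Sum>i=1..n. indicator {..t} (x i)) / n"
proof -
  interpret real_distribution "empirical_measure n x"
    using empirical_measure_P2[OF assms] by (rule P2_real_distribution)
  have "cdf (empirical_measure n x) t = (\<integral>s. indicator {..t} s \<partial>empirical_measure n x)"
    by (simp add: cdf_def)
  then show ?thesis
    using integral_empirical_measure[OF assms, of "indicator {..t}" x] by simp
qed

text \<open>An almost sure statement can hold for all rational points simultaneously, by
  countability. Monotonicity of the cdfs carries it from nearby rationals to x, and continuity of
  the limit cdf at x closes the gap.\<close>

lemma weak_conv_m_of_Rats:
  assumes "\<And>n. real_distribution (\<mu> n)" "real_distribution \<nu>"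
    and conv: "\<And>q. q \<in> \<rat> \<Longrightarrow> (\<lambda>n. cdf (\<mu> n) q) \<longlonglongrightarrow> cdf \<nu> q"
  shows "weak_conv_m \<mu> \<nu>"
  unfolding weak_conv_m_def weak_conv_def
proof (intro allI impI)
  interpret \<mu>: real_distribution "\<mu> n" for n by fact
  interpret \<nu>: real_distribution \<nu> by fact
  fix x assume x: "isCont (cdf \<nu>) x"
  show "(\<lambda>n. cdf (\<mu> n) x) \<longlonglongrightarrow> cdf \<nu> x"
  proof (rule order_tendstoI)
    fix a assume "a < cdf \<nu> x"
    then have "\<forall>\<^sub>F y in at_left x. a < cdf \<nu> y"
      using x by (intro order_tendstoD) (auto simp: continuous_at intro: tendsto_within_subset)
    then obtain b where b: "b < x" "\<And>y. b < y \<Longrightarrow> y < x \<Longrightarrow> a < cdf \<nu> y"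
      by (auto simp: eventually_at_left_field)
    obtain q where q: "q \<in> \<rat>" "b < q" "q < x"
      using Rats_dense_in_real[OF b(1)] by auto
    have "\<forall>\<^sub>F n in sequentially. a < cdf (\<mu> n) q"
      using order_tendstoD(1)[OF conv[OF q(1)]] b(2) q by auto
    then show "\<forall>\<^sub>F n in sequentially. a < cdf (\<mu> n) x"
      by eventually_elim (use q(3) \<mu>.cdf_nondecreasing[of q x] in \<open>auto intro: less_le_trans\<close>)
  next
    fix a assume "cdf \<nu> x < a"
    then have "\<forall>\<^sub>F y in at_right x. cdf \<nu> y < a"
      using x by (intro order_tendstoD) (auto simp: continuous_at intro: tendsto_within_subset)
    then obtain b where b: "x < b" "\<And>y. x < y \<Longrightarrow> y < b \<Longrightarrow> cdf \<nu> y < a"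
      by (auto simp: eventually_at_right_field)
    obtain q where q: "q \<in> \<rat>" "x < q" "q < b"
      using Rats_dense_in_real[OF b(1)] by auto
    have "\<forall>\<^sub>F n in sequentially. cdf (\<mu> n) q < a"
      using order_tendstoD(2)[OF conv[OF q(1)]] b(2) q by auto
    then show "\<forall>\<^sub>F n in sequentially. cdf (\<mu> n) x < a"
      by eventually_elim (use q(2) \<mu>.cdf_nondecreasing[of x q] in \<open>auto intro: le_less_trans\<close>)
  qed
qed

text \<open>The part of x outside [-K, K], signed. Its complement, the clamp, is bounded and also
  continuous, unlike a cutoff by an indicator; hence pointwise convergence of random variables
  passes to their clamps, and dominated convergence applies.\<close>

definition clamp_residual :: "nat \<Rightarrow> real \<Rightarrow> real" where
  "clamp_residual K x = x - max (- real K) (min (real K) x)"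

lemma measurable_clamp_residual [measurable]: "clamp_residual K \<in> borel_measurable borel"
  unfolding clamp_residual_def by measurable

lemma clamp_residual_square_le: "(clamp_residual K x)\<^sup>2 \<le> x\<^sup>2"
proof -
  have "\<bar>clamp_residual K x\<bar> \<le> \<bar>x\<bar>"
    by (auto simp: clamp_residual_def max_def min_def)
  then show ?thesis
    by (simp add: abs_le_square_iff)
qed

lemma integrable_clamp_residual_square:
  assumes [measurable]: "X \<in> borel_measurable M" and "integrable M (\<lambda>\<omega>. (X \<omega>)\<^sup>2)"
  shows "integrable M (\<lambda>\<omega>. (clamp_residual K (X \<omega>))\<^sup>2)"
  using assms(2) by (rule Bochner_Integration.integrable_bound) (auto simp: clamp_residual_square_le)

lemma integral_clamp_residual_tendsto_0:
  assumes "\<mu> \<in> P2"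
  shows "(\<lambda>K. \<integral>x. (clamp_residual K x)\<^sup>2 \<partial>\<mu>) \<longlonglongrightarrow> 0"
proof -
  interpret real_distribution \<mu>
    using assms by (rule P2_real_distribution)
  have "(\<lambda>K. \<integral>x. (clamp_residual K x)\<^sup>2 \<partial>\<mu>) \<longlonglongrightarrow> (\<integral>x. 0 \<partial>\<mu>)"
  proof (rule integral_dominated_convergence[where w = "\<lambda>x. x\<^sup>2"])
    show "integrable \<mu> (\<lambda>x. x\<^sup>2)"
      using assms by (simp add: P2_def)
    have "(\<lambda>K. (clamp_residual K x)\<^sup>2) \<longlonglongrightarrow> 0" for x
    proof (rule tendsto_eventually)
      obtain N :: nat where "\<bar>x\<bar> \<le> real N"
        using real_arch_simple by blast
      then show "\<forall>\<^sub>F K in sequentially. (clamp_residual K x)\<^sup>2 = 0"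
        by (auto simp: eventually_sequentially clamp_residual_def max_def min_def intro!: exI[of _ N])
    qed
    then show "AE x in \<mu>. (\<lambda>K. (clamp_residual K x)\<^sup>2) \<longlonglongrightarrow> 0"
      by simp
  qed (auto simp: clamp_residual_square_le)
  then show ?thesis by simp
qed

text \<open>On Skorohod's space the difference splits into two residuals and a difference of clamps.
  The latter vanishes in L^2 for fixed K; the residuals are small for large K. Any constant in place
  of the 2 in the tail bound would do, as the second moments of the residuals of \<nu> tend to
  0.\<close>

lemma W2_tendsto_0:
  assumes \<mu>: "\<And>n. \<mu> n \<in> P2" and \<nu>: "\<nu> \<in> P2" and weak: "weak_conv_m \<mu> \<nu>"
    and tail: "\<And>K. \<forall>\<^sub>F n in sequentially. (\<integral>x. (clamp_residual K x)\<^sup>2 \<partial>\<mu> n)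
       \<le> 2 * (\<integral>x. (clamp_residual K x)\<^sup>2 \<partial>\<nu>) + 1 / Suc K"
  shows "(\<lambda>n. W2 (\<mu> n) \<nu>) \<longlonglongrightarrow> 0"
proof -
  obtain \<Omega> :: "real measure" and Y Y0 where sk: "prob_space \<Omega> \<and> (\<forall>n. Y n \<in> measurable \<Omega> borel) \<and>
      (\<forall>n. distr \<Omega> borel (Y n) = \<mu> n) \<and> Y0 \<in> measurable \<Omega> lborel \<and> distr \<Omega> borel Y0 = \<nu> \<and>
      (\<forall>x \<in> space \<Omega>. (\<lambda>n. Y n x) \<longlonglongrightarrow> Y0 x)"
    using Skorohod[OF P2_real_distribution[OF \<mu>] P2_real_distribution[OF \<nu>] weak] by (elim exE)
  then have \<Omega>: "prob_space \<Omega>" and Y [measurable]: "\<And>n. Y n \<in> borel_measurable \<Omega>"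
    and Y_distr: "\<And>n. distr \<Omega> borel (Y n) = \<mu> n"
    and Y0 [measurable]: "Y0 \<in> borel_measurable \<Omega>" and Y0_distr: "distr \<Omega> borel Y0 = \<nu>"
    and lim: "\<And>\<omega>. \<omega> \<in> space \<Omega> \<Longrightarrow> (\<lambda>n. Y n \<omega>) \<longlonglongrightarrow> Y0 \<omega>"
    by simp_all
  interpret \<Omega>: prob_space \<Omega> by fact
  have Y_int: "integrable \<Omega> (\<lambda>\<omega>. (Y n \<omega>)\<^sup>2)" for n
    using \<mu>[of n] by (simp add: P2_def integrable_distr_eq flip: Y_distr)
  have Y0_int: "integrable \<Omega> (\<lambda>\<omega>. (Y0 \<omega>)\<^sup>2)"
    using \<nu> by (simp add: P2_def integrable_distr_eq flip: Y0_distr)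
  define e where "e K = (\<integral>x. (clamp_residual K x)\<^sup>2 \<partial>\<nu>)" for K
  define D where "D K n = (\<integral>\<omega>. ((Y n \<omega> - clamp_residual K (Y n \<omega>)) - (Y0 \<omega> - clamp_residual K (Y0 \<omega>)))\<^sup>2 \<partial>\<Omega>)" for K n
  have clamp_bound: "\<bar>x - clamp_residual K x\<bar> \<le> K" for x K
    by (auto simp: clamp_residual_def max_def min_def)
  have bound: "norm (((x - clamp_residual K x) - (y - clamp_residual K y))\<^sup>2) \<le> (2 * real K)\<^sup>2" for x y K
    unfolding real_norm_def abs_power2 using clamp_bound[of x K] clamp_bound[of y K]
    by (intro abs_le_square_iff[THEN iffD1]) linarith
  have D_int: "integrable \<Omega> (\<lambda>\<omega>. ((Y n \<omega> - clamp_residual K (Y n \<omega>)) - (Y0 \<omega> - clamp_residual K (Y0 \<omega>)))\<^sup>2)" for K n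
    by (rule \<Omega>.integrable_const_bound[where B = "(2 * real K)\<^sup>2", OF AE_I2[OF bound]]) measurable
  have D_lim: "D K \<longlonglongrightarrow> 0" for K
  proof -
    have "D K \<longlonglongrightarrow> (\<integral>\<omega>. 0 \<partial>\<Omega>)"
      unfolding D_def
    proof (rule integral_dominated_convergence[where w = "\<lambda>_. (2 * real K)\<^sup>2"])
      show "AE \<omega> in \<Omega>. (\<lambda>n. ((Y n \<omega> - clamp_residual K (Y n \<omega>)) - (Y0 \<omega> - clamp_residual K (Y0 \<omega>)))\<^sup>2) \<longlonglongrightarrow> 0"
      proof (rule AE_I2)
        fix \<omega> assume "\<omega> \<in> space \<Omega>"
        then have "(\<lambda>n. ((Y n \<omega> - clamp_residual K (Y n \<omega>)) - (Y0 \<omega> - clamp_residual K (Y0 \<omega>)))\<^sup>2)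
           \<longlonglongrightarrow> ((Y0 \<omega> - clamp_residual K (Y0 \<omega>)) - (Y0 \<omega> - clamp_residual K (Y0 \<omega>)))\<^sup>2"
          unfolding clamp_residual_def by (intro tendsto_intros lim)
        then show "(\<lambda>n. ((Y n \<omega> - clamp_residual K (Y n \<omega>)) - (Y0 \<omega> - clamp_residual K (Y0 \<omega>)))\<^sup>2) \<longlonglongrightarrow> 0"
          by simp
      qed
    next
      fix n
      show "AE \<omega> in \<Omega>. norm (((Y n \<omega> - clamp_residual K (Y n \<omega>)) - (Y0 \<omega> - clamp_residual K (Y0 \<omega>)))\<^sup>2) \<le> (2 * real K)\<^sup>2"
        by (intro AE_I2 bound)
    qed simp_all
    then show ?thesis by simp
  qed
  have W2_le: "(W2 (\<mu> n) \<nu>)\<^sup>2 \<le> 3 * (\<integral>x. (clamp_residual K x)\<^sup>2 \<partial>\<mu> n) + 3 * D K n + 3 * e K" for K n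
  proof -
    have "W2 (\<mu> n) \<nu> \<le> sqrt (\<integral>\<omega>. (Y n \<omega> - Y0 \<omega>)\<^sup>2 \<partial>\<Omega>)"
      using W2_le_random_variables[OF \<Omega>, of "Y n" Y0] integrable_diff_square[OF Y Y0 Y_int Y0_int]
      by (simp add: Y_distr Y0_distr)
    then have "(W2 (\<mu> n) \<nu>)\<^sup>2 \<le> (\<integral>\<omega>. (Y n \<omega> - Y0 \<omega>)\<^sup>2 \<partial>\<Omega>)"
      using power_mono[OF _ W2_nonneg, of "\<mu> n" \<nu> _ 2] by fastforce
    also have "\<dots> \<le> (\<integral>\<omega>. 3 * (clamp_residual K (Y n \<omega>))\<^sup>2
       + 3 * ((Y n \<omega> - clamp_residual K (Y n \<omega>)) - (Y0 \<omega> - clamp_residual K (Y0 \<omega>)))\<^sup>2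
       + 3 * (clamp_residual K (Y0 \<omega>))\<^sup>2 \<partial>\<Omega>)"
    proof (rule integral_mono)
      \<comment> \<open>The right-hand side minus the left-hand side is (a - b)^2 + (a + c)^2 + (b +
        c)^2.\<close>
      have three: "(a + b - c)\<^sup>2 \<le> 3 * a\<^sup>2 + 3 * b\<^sup>2 + 3 * c\<^sup>2" for a b c :: real
        using zero_le_power2[of "a - b"] zero_le_power2[of "a + c"] zero_le_power2[of "b + c"]
        by (simp add: power2_eq_square algebra_simps)
      fix \<omega>
      show "(Y n \<omega> - Y0 \<omega>)\<^sup>2 \<le> 3 * (clamp_residual K (Y n \<omega>))\<^sup>2
       + 3 * ((Y n \<omega> - clamp_residual K (Y n \<omega>)) - (Y0 \<omega> - clamp_residual K (Y0 \<omega>)))\<^sup>2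
       + 3 * (clamp_residual K (Y0 \<omega>))\<^sup>2"
        using three[of "clamp_residual K (Y n \<omega>)"
            "(Y n \<omega> - clamp_residual K (Y n \<omega>)) - (Y0 \<omega> - clamp_residual K (Y0 \<omega>))" "clamp_residual K (Y0 \<omega>)"]
        by simp
    qed (simp_all add: integrable_diff_square D_int integrable_clamp_residual_square Y_int Y0_int)
    also have "\<dots> = 3 * (\<integral>\<omega>. (clamp_residual K (Y n \<omega>))\<^sup>2 \<partial>\<Omega>) + 3 * D K n + 3 * (\<integral>\<omega>. (clamp_residual K (Y0 \<omega>))\<^sup>2 \<partial>\<Omega>)"
      by (simp add: D_def D_int integrable_clamp_residual_square Y_int Y0_int)
    also have "\<dots> = 3 * (\<integral>x. (clamp_residual K x)\<^sup>2 \<partial>\<mu> n) + 3 * D K n + 3 * e K"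
      by (simp add: e_def integral_distr flip: Y_distr Y0_distr)
    finally show ?thesis .
  qed
  have "(\<lambda>n. (W2 (\<mu> n) \<nu>)\<^sup>2) \<longlonglongrightarrow> 0"
  proof (rule order_tendstoI)
    fix a :: real assume "0 < a"
    \<comment> \<open>Inserting the tail bound into \<open>W2_le\<close> gives 3 * 2 + 3 = 9 copies
      of \<open>e K\<close>. Half of \<open>a\<close> is reserved for these terms, the other half
      for 3 * \<open>D K n\<close>.\<close>
    have "(\<lambda>K. 9 * e K + 3 * inverse (Suc K)) \<longlonglongrightarrow> 9 * 0 + 3 * 0"
      unfolding e_def
      by (intro tendsto_intros LIMSEQ_inverse_real_of_nat integral_clamp_residual_tendsto_0[OF \<nu>])
    then obtain K where K: "9 * e K + 3 * inverse (Suc K) < a / 2"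
      using order_tendstoD(2)[of _ _ sequentially "a / 2"] \<open>0 < a\<close> eventually_happens[of _ sequentially] by fastforce
    have "\<forall>\<^sub>F n in sequentially. D K n < a / 6"
      using \<open>0 < a\<close> by (intro order_tendstoD(2)[OF D_lim]) simp
    then show "\<forall>\<^sub>F n in sequentially. (W2 (\<mu> n) \<nu>)\<^sup>2 < a"
      using tail[of K]
    proof eventually_elim
      case (elim n)
      have "1 / real (Suc K) = inverse (real (Suc K))"
        by (simp add: divide_inverse)
      with elim show ?case
        using W2_le[of n K] K unfolding e_def[symmetric] by linarith
    qed
  next
    fix a :: real assume "a < 0"
    then have "a < (W2 (\<mu> n) \<nu>)\<^sup>2" for n
      by (rule less_le_trans) simp
    then show "\<forall>\<^sub>F n in sequentially. a < (W2 (\<mu> n) \<nu>)\<^sup>2"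
      by simp
  qed
  then have "(\<lambda>n. sqrt ((W2 (\<mu> n) \<nu>)\<^sup>2)) \<longlonglongrightarrow> sqrt 0"
    by (rule tendsto_real_sqrt)
  then show ?thesis
    by (simp add: W2_nonneg)
qed

lemma (in iid_random_variables) W2_empirical_measure_tendsto_0_AE:
  assumes \<mu>: "\<mu> \<in> P2"
  shows "AE \<omega> in M. (\<lambda>n. W2 (empirical_measure n (\<lambda>i. X i \<omega>)) \<mu>) \<longlonglongrightarrow> 0"
proof -
  interpret \<mu>: real_distribution \<mu>
    using \<mu> by (rule P2_real_distribution)
  have cdf: "AE \<omega> in M. \<forall>q\<in>\<rat>. (\<lambda>n. (\<Sum>i=1..n. indicator {..q} (X i \<omega>)) / n) \<longlonglongrightarrow> cdf \<mu> q"
    unfolding AE_ball_countable[OF countable_rat] cdf_def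
    by (intro ballI averages_indicator_tendsto_AE) simp
  have tail: "AE \<omega> in M. \<forall>K. \<forall>\<^sub>F n in sequentially. (\<Sum>i=1..n. (clamp_residual K (X i \<omega>))\<^sup>2) / n
      \<le> 2 * (\<integral>x. (clamp_residual K x)\<^sup>2 \<partial>\<mu>) + 1 / Suc K"
    unfolding AE_all_countable
  proof
    fix K
    let ?g = "\<lambda>x. (clamp_residual K x)\<^sup>2"
    interpret Y: iid_random_variables M "\<lambda>i \<omega>. ?g (X i \<omega>)" "distr \<mu> borel ?g"
      by (rule compose) simp
    have "integrable \<mu> ?g"
      using integrable_clamp_residual_square[of "\<lambda>x. x" \<mu>] \<mu> by (simp add: P2_def)
    then have "integrable (distr \<mu> borel ?g) (\<lambda>x. x)"
      by (simp add: integrable_distr_eq)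
    \<comment> \<open>The choice \<epsilon> = 1/(2(K+1)) makes the doubled error equal to the
      1/(K+1) in \<open>W2_tendsto_0\<close>.\<close>
    then have "AE \<omega> in M. \<forall>\<^sub>F n in sequentially. (\<Sum>i=1..n. ?g (X i \<omega>)) / n
        \<le> 2 * ((\<integral>x. x \<partial>distr \<mu> borel ?g) + 1 / (2 * Suc K))"
      by (intro Y.averages_bounded_AE) simp_all
    moreover have "2 * ((\<integral>x. x \<partial>distr \<mu> borel ?g) + 1 / (2 * Suc K)) = 2 * (\<integral>x. ?g x \<partial>\<mu>) + 1 / Suc K"
      by (simp add: integral_distr field_simps)
    ultimately show "AE \<omega> in M. \<forall>\<^sub>F n in sequentially. (\<Sum>i=1..n. ?g (X i \<omega>)) / n
        \<le> 2 * (\<integral>x. ?g x \<partial>\<mu>) + 1 / Suc K"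
      by (simp only:)
  qed
  show ?thesis
    using cdf tail
  proof eventually_elim
    case (elim \<omega>)
    \<comment> \<open>The empirical measure for n = 0 is the zero measure, which is not in
      \<open>P2\<close>; the sequence is therefore shifted by one.\<close>
    let ?\<mu> = "\<lambda>n. empirical_measure (Suc n) (\<lambda>i. X i \<omega>)"
    have P2: "?\<mu> n \<in> P2" for n
      by (simp add: empirical_measure_P2)
    have "(\<lambda>n. W2 (?\<mu> n) \<mu>) \<longlonglongrightarrow> 0"
    proof (rule W2_tendsto_0[OF P2 \<mu>])
      show "weak_conv_m ?\<mu> \<mu>"
      proof (rule weak_conv_m_of_Rats)
        fix q :: real assume "q \<in> \<rat>"
        then have "(\<lambda>n. (\<Sum>i=1..n. indicator {..q} (X i \<omega>)) / n) \<longlonglongrightarrow> cdf \<mu> q"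
          using elim(1) by blast
        from LIMSEQ_Suc[OF this] show "(\<lambda>n. cdf (?\<mu> n) q) \<longlonglongrightarrow> cdf \<mu> q"
          by (subst cdf_empirical_measure) simp_all
      qed (use P2 in \<open>auto intro: P2_real_distribution \<mu>.real_distribution_axioms\<close>)
      fix K
      from eventually_compose_filterlim[OF elim(2)[rule_format, of K] filterlim_Suc]
      show "\<forall>\<^sub>F n in sequentially. (\<integral>x. (clamp_residual K x)\<^sup>2 \<partial>?\<mu> n)
          \<le> 2 * (\<integral>x. (clamp_residual K x)\<^sup>2 \<partial>\<mu>) + 1 / Suc K"
        by (subst integral_empirical_measure) simp_all
    qed
    then show ?case
      by (rule LIMSEQ_imp_Suc)
  qed
qed

theorem theorem2p14:
  fixes F :: "real measure set"
    and \<mu>star :: "real measure"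
    and M :: "'a measure"
    and X :: "nat \<Rightarrow> 'a \<Rightarrow> real"
  assumes "F \<noteq> {}" and "F \<subseteq> P2" and "displacement_convex F" and "W2_closed F"
    and "\<mu>star \<in> P2"
    and "prob_space M"
    and "prob_space.indep_vars M (\<lambda>_. borel) X {1..}"
    and "\<And>i. i \<ge> 1 \<Longrightarrow> distr M borel (X i) = \<mu>star"
  shows "(\<forall>n\<ge>1. \<forall>\<omega>\<in>space M.
            W2 (W2_proj F (empirical_measure n (\<lambda>i. X i \<omega>))) (W2_proj F \<mu>star)
              \<le> W2 (empirical_measure n (\<lambda>i. X i \<omega>)) \<mu>star)
       \<and> (AE \<omega> in M.
            (\<lambda>n. W2 (W2_proj F (empirical_measure n (\<lambda>i. X i \<omega>))) (W2_proj F \<mu>star))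
              \<longlonglongrightarrow> 0)"
proof -
  interpret iid_random_variables M X \<mu>star
    by (rule iid_random_variables.intro[OF assms(6)], unfold_locales) (fact assms)+
  have contraction: "W2 (W2_proj F (empirical_measure n (\<lambda>i. X i \<omega>))) (W2_proj F \<mu>star)
      \<le> W2 (empirical_measure n (\<lambda>i. X i \<omega>)) \<mu>star" if "n \<ge> 1" for n \<omega>
    using assms(1-5) empirical_measure_P2[OF that] by (intro W2_proj_nonexpansive)
  have "AE \<omega> in M. (\<lambda>n. W2 (W2_proj F (empirical_measure n (\<lambda>i. X i \<omega>))) (W2_proj F \<mu>star)) \<longlonglongrightarrow> 0"
    using W2_empirical_measure_tendsto_0_AE[OF assms(5)]
  proof eventually_elim
    case (elim \<omega>)
    have "\<forall>\<^sub>F n in sequentially. W2 (W2_proj F (empirical_measure n (\<lambda>i. X i \<omega>))) (W2_proj F \<mu>star)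
        \<le> W2 (empirical_measure n (\<lambda>i. X i \<omega>)) \<mu>star"
      using eventually_ge_at_top[of 1] by eventually_elim (rule contraction)
    from tendsto_sandwich[OF _ this tendsto_const elim] show ?case
      by (simp add: W2_nonneg)
  qed
  with contraction show ?thesis by simp
qed

end
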